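(* Let $\kappa, r, \ell$ be nonnegative integers and let $g$ be of the form $$g=i\cdot\frac{b_2+b_1}{b_2-b_1}\quad\text{where}\quad b_1\in\mathcal{B}_\ell(\mathbb{C}^+),\quad b_2\in\mathcal{B}_r(\mathbb{C}^+),\quad Z(b_1)\cap Z(b_2)=\emptyset$$ (here the factor $i$ is the imaginary unit). Let $n\ge 1$, let $\lambda_2,\ldots,\lambda_n$ be distinct real points, let $m_1,\ldots,m_n$ be nonnegative integers, and assume that a function $h\in\mathcal{N}_{\le\kappa}$ satisfies the asymptotic equations $$h(\zeta)=g(\zeta)+o((\zeta-\lambda_j)^{m_j})\quad\text{for}\quad j=2,\ldots,n$$ as $\zeta\in\mathbb{C}^+$ tends to $\lambda_j$ nontangentially, and the asymptotic equation $$h(\zeta)=g(\zeta)+o(|\zeta|^{-m_1})$$ as $\zeta$ tends to infinity staying inside the angle $\{\zeta:\ \epsilon<\arg\zeta<\pi-\epsilon\}$, for every $\epsilon\in(0,\pi/2)$. If $$\left[\frac{m_1+1}{2}\right]+\ldots+\left[\frac{m_n+1}{2}\right]>\kappa+\ell,$$ then $h\equiv g$.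
   Context: $\mathbb{C}^+$ is the open upper half-plane. $[x]$ denotes the largest integer not exceeding the real number $x$. $\mathcal{B}_k(\mathbb{C}^+)$ denotes the set of finite Blaschke products of the form $$b(\zeta)=\prod_{j=1}^k\frac{\zeta-a_j}{\zeta-\bar{a}_j}\qquad(\zeta,\,a_j\in\mathbb{C}^+).$$ $Z(b)$ is the zero set of $b$ (in $\mathbb{C}^+$). A Hermitian kernel $K(z,\zeta)$ on a set $\Omega$ has $k$ negative squares if for every finite choice of points $z_1,\ldots,z_N\in\Omega$ the Hermitian matrix $[K(z_i,z_j)]_{i,j=1}^N$ has at most $k$ negative eigenvalues (counted with multiplicity), and exactly $k$ for at least one such choice. The generalized Nevanlinna class $\mathcal{N}_k$ consists of all functions $h$ meromorphic on $\mathbb{C}^+$ such that the kernel $$N_h(z,\zeta)=\frac{h(z)-\overline{h(\zeta)}}{z-\overline{\zeta}}$$ has $k$ negative squares on $\mathbb{C}^+\cap\mathrm{Dom}(h)$, where $\mathrm{Dom}(h)$ is the domain of analyticity of $h$; by convention the function $h\equiv\infty$ is also included in $\mathcal{N}_0$. Further, $\mathcal{N}_{\le\kappa}=\bigcup_{q\le\kappa}\mathcal{N}_q$. "$\zeta$ tends to $\lambda$ nontangentially" means that $\zeta\to\lambda$ within any fixed angle $\{\zeta:\ \epsilon<\arg(\zeta-\lambda)<\pi-\epsilon\}$, $\epsilon\in(0,\pi/2)$, with vertex $\lambda\in\mathbb{R}$. The asymptotic equations are statements about the difference $h-g$, and so presuppose that neither $h$ nor $g$ is identically $\infty$. *)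

theory Defs
  imports
    "Jordan_Normal_Form.Char_Poly"
    "HOL-Complex_Analysis.Complex_Analysis"
    "HOL-Library.Landau_Symbols"
begin

definition upper_half_plane :: "complex set" where
  "upper_half_plane = {z. Im z > 0}"

text \<open>A function is only constrained on the upper half-plane, and no unimodular
  constant factor is allowed, so that the only element for \<open>k = 0\<close> is the constant 1.\<close>

definition blaschke_products :: "nat \<Rightarrow> (complex \<Rightarrow> complex) set" where
  "blaschke_products k =
     {b. \<exists>a. (\<forall>j\<in>{1..k}. a j \<in> upper_half_plane) \<and>
             (\<forall>z\<in>upper_half_plane. b z = (\<Prod>j=1..k. (z - a j) / (z - cnj (a j))))}"

definition zero_set :: "(complex \<Rightarrow> complex) \<Rightarrow> complex set" where
  "zero_set b = {z \<in> upper_half_plane. b z = 0}"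

text \<open>The number of negative eigenvalues, with their multiplicities as roots of the
  characteristic polynomial. For the Hermitian matrices below these are also the
  geometric multiplicities, and all eigenvalues are real.\<close>

definition negative_eigenvalue_count :: "complex Matrix.mat \<Rightarrow> nat" where
  "negative_eigenvalue_count A =
     (\<Sum>x | Char_Poly.eigenvalue A x \<and> x \<in> \<real> \<and> Re x < 0. Polynomial.order x (char_poly A))"

text \<open>The points of a finite choice are not required to be distinct.\<close>

definition kernel_matrix ::
    "(complex \<Rightarrow> complex \<Rightarrow> complex) \<Rightarrow> nat \<Rightarrow> (nat \<Rightarrow> complex) \<Rightarrow> complex Matrix.mat" where
  "kernel_matrix K N z = Matrix.mat N N (\<lambda>(i, j). K (z i) (z j))"

definition hermitian_kernel_on ::
    "complex set \<Rightarrow> (complex \<Rightarrow> complex \<Rightarrow> complex) \<Rightarrow> bool" where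
  "hermitian_kernel_on \<Omega> K \<longleftrightarrow> (\<forall>z\<in>\<Omega>. \<forall>\<zeta>\<in>\<Omega>. K z \<zeta> = cnj (K \<zeta> z))"

definition has_negative_squares ::
    "complex set \<Rightarrow> (complex \<Rightarrow> complex \<Rightarrow> complex) \<Rightarrow> nat \<Rightarrow> bool" where
  "has_negative_squares \<Omega> K k \<longleftrightarrow>
     hermitian_kernel_on \<Omega> K \<and>
     (\<forall>N z. (\<forall>i<N. z i \<in> \<Omega>) \<longrightarrow> negative_eigenvalue_count (kernel_matrix K N z) \<le> k) \<and>
     (\<exists>N z. (\<forall>i<N. z i \<in> \<Omega>) \<and> negative_eigenvalue_count (kernel_matrix K N z) = k)"

definition nevanlinna_kernel ::
    "(complex \<Rightarrow> complex) \<Rightarrow> complex \<Rightarrow> complex \<Rightarrow> complex" where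
  "nevanlinna_kernel h z \<zeta> = (h z - cnj (h \<zeta>)) / (z - cnj \<zeta>)"

definition analyticity_domain :: "(complex \<Rightarrow> complex) \<Rightarrow> complex set" where
  "analyticity_domain h = {z \<in> upper_half_plane. h analytic_on {z}}"

text \<open>A meromorphic function is represented by its normalised version (removable
  singularities filled in, value 0 at poles); two such functions are equal as meromorphic
  functions iff they agree at every point. \<open>None\<close> is the function identically \<open>\<infinity>\<close>.\<close>

definition generalized_nevanlinna :: "nat \<Rightarrow> (complex \<Rightarrow> complex) option set" where
  "generalized_nevanlinna k =
     Some ` {h. h nicely_meromorphic_on upper_half_plane \<and>
                has_negative_squares (analyticity_domain h) (nevanlinna_kernel h) k}
     \<union> (if k = 0 then {None} else {})"

definition generalized_nevanlinna_le :: "nat \<Rightarrow> (complex \<Rightarrow> complex) option set" where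
  "generalized_nevanlinna_le \<kappa> = (\<Union>q\<le>\<kappa>. generalized_nevanlinna q)"

text \<open>\<open>Arg\<close> has values in \<open>(-\<pi>, \<pi>]\<close> and \<open>Arg 0 = 0\<close>, so for \<open>\<epsilon> > 0\<close> the angle lies above
  its vertex and does not contain it.\<close>

definition angle_at :: "complex \<Rightarrow> real \<Rightarrow> complex set" where
  "angle_at c \<epsilon> = {\<zeta>. \<epsilon> < Arg (\<zeta> - c) \<and> Arg (\<zeta> - c) < pi - \<epsilon>}"

definition angle_filter_at :: "real \<Rightarrow> real \<Rightarrow> complex filter" where
  "angle_filter_at x \<epsilon> = at (complex_of_real x) within angle_at (complex_of_real x) \<epsilon>"

definition angle_filter_infinity :: "real \<Rightarrow> complex filter" where
  "angle_filter_infinity \<epsilon> = inf at_infinity (principal (angle_at 0 \<epsilon>))"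

end

theory Submission
  imports Defs "Jordan_Normal_Form.Jordan_Normal_Form_Existence"
begin

text \<open>
  The difference \<open>f = h - g\<close> is studied through its Nevanlinna kernel. Writing \<open>g\<close> in terms of
  \<open>b1\<close> and \<open>b2\<close> expresses the kernel of \<open>- g\<close> as a sum of squares minus a sum of \<open>l\<close> squares
  (the Blaschke kernel \<open>\<i> * (1 - b z * cnj (b w)) / (z - cnj w)\<close> is a sum of as many squares as
  \<open>b\<close> has factors). Hence, on the set where both functions are regular, the kernel of \<open>f\<close> is
  the sum of one with at most \<open>\<kappa>\<close> and one with at most \<open>l\<close> negative squares. What has to be
  shown is that \<open>f = 0\<close> if its form has at most \<open>k\<close> negative squares and
  \<open>(m j + 1) div 2\<close>, summed over the boundary points, exceeds \<open>k\<close>.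

  The kernel form of \<open>f\<close> evaluated at a coefficient vector \<open>c\<close> on a finite set of points is
  twice the real part of \<open>\<Sum>x. c x * f x * cnj (\<Phi> (cnj x))\<close>, where \<open>\<Phi>\<close> is the rational
  function with simple poles \<open>x\<close> and residues \<open>c x\<close>. So the vectors are rational functions
  with poles in the upper half-plane. Let the poles approach the boundary points \<open>\<lambda> j\<close>
  vertically, \<open>p j = (m j + 1) div 2\<close> of them at each, so that \<open>\<Phi>\<close> tends to
  \<open>q x / (\<Prod>j. (x - \<lambda> j) ^ p j)\<close> with \<open>degree q < D\<close>, where \<open>D\<close> is the sum of the \<open>p j\<close>. The residues may grow like
  \<open>t powr (1 - p j)\<close> and the values at the conjugate poles like \<open>t powr (- p j)\<close>, but
  \<open>f\<close> is \<open>o(t ^ (2 * p j - 1))\<close> there: this \<open>D\<close>-dimensional space becomes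
  isotropic in the limit. It is paired with the vectors supported on \<open>D\<close> fixed points \<open>w\<close>, and the
  pairing only involves \<open>f w\<close> and the value of the limit of \<open>\<Phi>\<close> at \<open>cnj w\<close>. If \<open>f\<close> is nonzero
  at these points, the pairing is nondegenerate by polynomial interpolation, and an isotropic
  space of dimension \<open>D\<close> which is paired nondegenerately with another space forces \<open>D\<close> negative
  squares. Since \<open>D > k\<close>, the function \<open>f\<close> vanishes at all but finitely many regular points,
  hence everywhere.

  Three reductions make this work. The number of negative eigenvalues is replaced by the
  existence of that many linear functionals on whose common kernel the form is nonnegative; the
  passage from one to the other is the spectral theorem for Hermitian matrices, obtained here
  from the Jordan normal form. The point at infinity is moved to the origin by
  \<open>\<zeta> = \<mu> - 1 / z\<close>, which only rescales the kernel. Finally the poles of \<open>h\<close> may accumulate at the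
  boundary, but they are countably many, so the approaching points can avoid them.
\<close>

section \<open>Negative eigenvalues of Hermitian matrices\<close>

lemma jordan_matrix_nonzero_entry:
  assumes "i < sum_list (map fst bs)" "j < sum_list (map fst bs)"
    and "jordan_matrix bs $$ (i, j) \<noteq> (0 :: complex)"
  shows "j = i \<or> j = Suc i \<and> jordan_matrix bs $$ (i, i) = jordan_matrix bs $$ (j, j)"
  using assms
proof (induction bs arbitrary: i j)
  case (Cons b bs)
  obtain k a where b: "b = (k, a)" by (cases b)
  show ?case
  proof (cases "i < k \<or> j < k")
    case True
    then show ?thesis
      using Cons.prems by (auto simp: b jordan_matrix_Cons split: if_splits)
  next
    case False
    then show ?thesis
      using Cons.prems Cons.IH[of "i - k" "j - k"]
      by (simp add: b jordan_matrix_Cons split: if_splits) linarith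
  qed
qed simp

lemma order_prod_linear_factors:
  "Polynomial.order x (\<Prod>a\<leftarrow>as. [:- a, 1:]) = count_list as (x :: complex)"
proof (induction as)
  case (Cons a as)
  have "(\<Prod>a\<leftarrow>as. [:- a, 1:]) \<noteq> (0 :: complex poly)"
    by (auto simp: prod_list_zero_iff)
  then have "Polynomial.order x ([:- a, 1:] * (\<Prod>a\<leftarrow>as. [:- a, 1:])) =
      Polynomial.order x [:- a, 1:] + Polynomial.order x (\<Prod>a\<leftarrow>as. [:- a, 1:])"
    by (intro order_mult no_zero_divisors) auto
  moreover have "Polynomial.order x [:- a, 1:] = (if x = a then 1 else 0)"
    using order_power_n_n[of a 1] by (auto intro!: order_0I)
  moreover have "(\<Prod>a\<leftarrow>a # as. [:- a, 1:]) = [:- a, 1:] * (\<Prod>a\<leftarrow>as. [:- a, 1:])"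
    by (simp only: list.map prod_list.Cons)
  ultimately show ?case
    using Cons.IH by (simp only: count_list.simps) simp
qed (auto intro: order_0I)

lemma sum_count_list_filter:
  assumes "finite S"
  shows "(\<Sum>x\<in>S. count_list as x) = length (filter (\<lambda>x. x \<in> S) as)"
proof (induction as)
  case (Cons a as)
  have "(\<Sum>x\<in>S. count_list (a # as) x) = (\<Sum>x\<in>S. count_list as x + (if x = a then 1 else 0))"
    by (intro sum.cong) auto
  then show ?case
    using Cons assms by (simp add: sum.distrib)
qed simp

lemma negative_eigenvalue_count_similar_diagonal:
  assumes A: "A \<in> carrier_mat n n" and J: "J \<in> carrier_mat n n" "upper_triangular J"
    and sim: "similar_mat A J"
  shows "negative_eigenvalue_count A = card {k. k < n \<and> J $$ (k, k) \<in> \<real> \<and> Re (J $$ (k, k)) < 0}"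
proof -
  let ?S = "{x. Char_Poly.eigenvalue A x \<and> x \<in> \<real> \<and> Re x < 0}"
  have char_poly: "char_poly A = (\<Prod>a\<leftarrow>diag_mat J. [:- a, 1:])"
    using char_poly_similar[OF sim] char_poly_upper_triangular[OF J] by simp
  have eigen: "Char_Poly.eigenvalue A x \<longleftrightarrow> x \<in> set (diag_mat J)" for x
    unfolding eigenvalue_root_char_poly[OF A] char_poly
    by (auto simp: poly_prod_list prod_list_zero_iff)
  have "finite ?S"
    by (rule finite_subset[of _ "set (diag_mat J)"]) (auto simp: eigen)
  then have "negative_eigenvalue_count A = length (filter (\<lambda>x. x \<in> ?S) (diag_mat J))"
    unfolding negative_eigenvalue_count_def char_poly order_prod_linear_factors
    by (rule sum_count_list_filter)
  also have "\<dots> = card {k. k < n \<and> J $$ (k, k) \<in> ?S}"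
    using J by (auto simp: length_filter_conv_card diag_mat_def intro!: arg_cong[of _ _ card])
  also have "{k. k < n \<and> J $$ (k, k) \<in> ?S} = {k. k < n \<and> J $$ (k, k) \<in> \<real> \<and> Re (J $$ (k, k)) < 0}"
    using J by (auto simp: eigen diag_mat_def)
  finally show ?thesis .
qed

definition hermitian_entries :: "nat \<Rightarrow> complex Matrix.mat \<Rightarrow> bool" where
  "hermitian_entries n A \<longleftrightarrow> (\<forall>i<n. \<forall>j<n. A $$ (i, j) = cnj (A $$ (j, i)))"

lemma hermitian_adjoint:
  assumes "hermitian_entries n A"
  shows "(\<Sum>i<n. (\<Sum>j<n. A $$ (i, j) * v j) * cnj (w i)) =
         (\<Sum>i<n. v i * cnj (\<Sum>j<n. A $$ (i, j) * w j))"
proof -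
  have "(\<Sum>i<n. (\<Sum>j<n. A $$ (i, j) * v j) * cnj (w i)) =
      (\<Sum>i<n. \<Sum>j<n. A $$ (i, j) * v j * cnj (w i))"
    by (simp add: sum_distrib_right)
  also have "\<dots> = (\<Sum>j<n. \<Sum>i<n. A $$ (i, j) * v j * cnj (w i))"
    by (rule sum.swap)
  also have "\<dots> = (\<Sum>j<n. \<Sum>i<n. v j * cnj (A $$ (j, i) * w i))"
  proof (intro sum.cong refl)
    fix i j assume "j \<in> {..<n}" "i \<in> {..<n}"
    then have "A $$ (i, j) = cnj (A $$ (j, i))"
      using assms unfolding hermitian_entries_def by blast
    then show "A $$ (i, j) * v j * cnj (w i) = v j * cnj (A $$ (j, i) * w i)"
      by simp
  qed
  also have "\<dots> = (\<Sum>i<n. v i * cnj (\<Sum>j<n. A $$ (i, j) * w j))"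
    by (simp add: sum_distrib_left cnj_sum)
  finally show ?thesis .
qed

lemma sum_norm_square_zero:
  assumes "(\<Sum>i<n. p i * cnj (p i)) = (0 :: complex)" "i < (n :: nat)"
  shows "p i = 0"
proof -
  have "complex_of_real (\<Sum>i<n. (cmod (p i))\<^sup>2) = 0"
    using assms(1) by (simp add: complex_mult_cnj cmod_power2)
  then have "(\<Sum>i<n. (cmod (p i))\<^sup>2) = 0"
    using of_real_eq_0_iff by blast
  then show ?thesis
    using assms(2) by (simp add: sum_nonneg_eq_0_iff)
qed

lemma hermitian_eigenvalue_real:
  assumes A: "hermitian_entries n A"
    and eig: "\<And>i. i < n \<Longrightarrow> (\<Sum>j<n. A $$ (i, j) * p j) = \<mu> * p i"
    and nz: "\<exists>i<n. p i \<noteq> 0"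
  shows "\<mu> \<in> \<real>"
proof -
  have "\<mu> * (\<Sum>i<n. p i * cnj (p i)) = cnj \<mu> * (\<Sum>i<n. p i * cnj (p i))"
  proof -
    have "(\<Sum>i<n. (\<mu> * p i) * cnj (p i)) = (\<Sum>i<n. p i * cnj (\<mu> * p i))"
      using hermitian_adjoint[OF A, of p p] eig by simp
    then show ?thesis
      by (simp add: sum_distrib_left mult_ac)
  qed
  moreover have "(\<Sum>i<n. p i * cnj (p i)) \<noteq> 0"
    using sum_norm_square_zero[where p = p] nz by blast
  ultimately have "\<mu> = cnj \<mu>"
    by simp
  then show ?thesis
    by (simp add: Reals_cnj_iff)
qed

text \<open>Moving \<open>A - \<mu>\<close> from \<open>q\<close> to \<open>p\<close> in the inner product of \<open>(A - \<mu>) q = \<epsilon> p\<close> with \<open>p\<close>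
  gives \<open>\<epsilon> \<parallel>p\<parallel>\<^sup>2 = 0\<close>. This is what rules out Jordan blocks of size at least 2.\<close>

lemma hermitian_no_generalized_eigenvector:
  assumes A: "hermitian_entries n A"
    and eig: "\<And>i. i < n \<Longrightarrow> (\<Sum>j<n. A $$ (i, j) * p j) = \<mu> * p i"
    and gen: "\<And>i. i < n \<Longrightarrow> (\<Sum>j<n. A $$ (i, j) * q j) = \<mu> * q i + \<epsilon> * p i"
    and nz: "\<exists>i<n. p i \<noteq> 0"
  shows "\<epsilon> = 0"
proof -
  have "cnj \<mu> = \<mu>"
    using hermitian_eigenvalue_real[OF A eig nz] by (simp add: Reals_cnj_iff)
  then have "\<epsilon> * (\<Sum>i<n. p i * cnj (p i)) = 0"
  proof -
    have "(\<Sum>i<n. (\<mu> * q i + \<epsilon> * p i) * cnj (p i)) = (\<Sum>i<n. q i * cnj (\<mu> * p i))"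
      using hermitian_adjoint[OF A, of q p] eig gen by simp
    then show ?thesis
      using \<open>cnj \<mu> = \<mu>\<close> by (simp add: sum_distrib_left sum.distrib algebra_simps)
  qed
  moreover have "(\<Sum>i<n. p i * cnj (p i)) \<noteq> 0"
    using sum_norm_square_zero[where p = p] nz by blast
  ultimately show ?thesis
    by simp
qed


lemma similar_matrix_columns:
  fixes A :: "complex Matrix.mat"
  assumes "J \<in> carrier_mat n n" "P \<in> carrier_mat n n" "Q \<in> carrier_mat n n"
    and A: "A = P * J * Q" and QP: "Q * P = 1\<^sub>m n"
    and "i < n" "k < n"
  shows "(\<Sum>j<n. A $$ (i, j) * P $$ (j, k)) = (\<Sum>l<n. P $$ (i, l) * J $$ (l, k))"
proof -
  have PJ: "P * J \<in> carrier_mat n n"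
    using assms by simp
  have "A * P = P * J * (Q * P)"
    unfolding A by (rule assoc_mult_mat) (use assms PJ in auto)
  also have "\<dots> = P * J"
    unfolding QP by (rule right_mult_one_mat[OF PJ])
  finally have AP: "A * P = P * J" .
  have carrier: "A \<in> carrier_mat n n"
    unfolding A using assms PJ by simp
  show ?thesis
    using arg_cong[OF AP, of "\<lambda>M. M $$ (i, k)"] carrier assms(1,2,6,7)
    by (simp add: scalar_prod_def atLeast0LessThan)
qed

lemma left_invertible_column_nonzero:
  fixes P :: "complex Matrix.mat"
  assumes "P \<in> carrier_mat n n" "Q \<in> carrier_mat n n" "Q * P = 1\<^sub>m n" "k < n"
  shows "\<exists>i<n. P $$ (i, k) \<noteq> 0"
proof (rule ccontr)
  assume "\<not> ?thesis"
  then have "(Q * P) $$ (k, k) = 0"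
    using assms(1,2,4) by (simp add: scalar_prod_def)
  then show False
    using assms(3,4) by simp
qed

text \<open>The Jordan form of a Hermitian matrix is diagonal: at the first nonzero entry above the
  diagonal, the preceding column of \<open>P\<close> is a genuine eigenvector, and the next one would be a
  generalized eigenvector above it.\<close>

lemma hermitian_similar_diagonal:
  assumes A: "A \<in> carrier_mat n n" "hermitian_entries n A"
  obtains J P Q where "J \<in> carrier_mat n n" "P \<in> carrier_mat n n" "Q \<in> carrier_mat n n"
    and "A = P * J * Q" "P * Q = 1\<^sub>m n" "Q * P = 1\<^sub>m n"
    and "\<And>i j. i < n \<Longrightarrow> j < n \<Longrightarrow> i \<noteq> j \<Longrightarrow> J $$ (i, j) = 0"
proof -
  obtain as where "char_poly A = (\<Prod>a\<leftarrow>as. [:- a, 1:])"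
    using char_poly_factorized[OF A(1)] by auto
  from jordan_nf_exists[OF A(1) this] obtain bs where "jordan_nf A bs" ..
  define J where "J = jordan_matrix bs"
  have "similar_mat A J"
    using \<open>jordan_nf A bs\<close> by (simp add: jordan_nf_def J_def)
  then obtain P Q where "similar_mat_wit A J P Q"
    unfolding similar_mat_def by auto
  note wit = similar_mat_witD2[OF A(1) this]
  have dim: "sum_list (map fst bs) = n"
    using carrier_matD(1)[OF wit(5)] jordan_matrix_dim(1)[of bs] unfolding J_def by simp
  have bidiagonal: "j = i \<or> j = Suc i \<and> J $$ (i, i) = J $$ (j, j)"
    if "i < n" "j < n" "J $$ (i, j) \<noteq> 0" for i j
    using jordan_matrix_nonzero_entry[of i bs j] that by (simp add: J_def dim)
  note column = similar_matrix_columns[OF wit(5-7) wit(3,2)]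
  note column_nonzero = left_invertible_column_nonzero[OF wit(6,7,2)]
  have superdiagonal: "J $$ (k, Suc k) = 0" if "Suc k < n" for k
    using that
  proof (induction k rule: less_induct)
    case (less k)
    have "(\<Sum>l<n. P $$ (i, l) * J $$ (l, k)) = J $$ (k, k) * P $$ (i, k)" if "i < n" for i
    proof -
      have "(\<Sum>l<n. P $$ (i, l) * J $$ (l, k)) =
          (\<Sum>l<n. if l = k then J $$ (k, k) * P $$ (i, k) else 0)"
      proof (intro sum.cong refl)
        fix l assume "l \<in> {..<n}"
        then show "P $$ (i, l) * J $$ (l, k) = (if l = k then J $$ (k, k) * P $$ (i, k) else 0)"
          using bidiagonal[of l k] less by (cases "l = k") auto
      qed
      then show ?thesis
        using less.prems by simp
    qed
    then have eig: "(\<Sum>j<n. A $$ (i, j) * P $$ (j, k)) = J $$ (k, k) * P $$ (i, k)" if "i < n" for i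
      using column[of i k] that less.prems by simp
    show ?case
    proof (rule ccontr)
      assume nz: "J $$ (k, Suc k) \<noteq> 0"
      then have diag: "J $$ (k, k) = J $$ (Suc k, Suc k)"
        using bidiagonal[of k "Suc k"] less.prems by simp
      have "(\<Sum>l<n. P $$ (i, l) * J $$ (l, Suc k)) =
          J $$ (k, k) * P $$ (i, Suc k) + J $$ (k, Suc k) * P $$ (i, k)" if "i < n" for i
      proof -
        have "(\<Sum>l<n. P $$ (i, l) * J $$ (l, Suc k)) =
            (\<Sum>l<n. (if l = Suc k then J $$ (k, k) * P $$ (i, Suc k) else 0) +
              (if l = k then J $$ (k, Suc k) * P $$ (i, k) else 0))"
        proof (intro sum.cong refl)
          fix l assume "l \<in> {..<n}"
          then show "P $$ (i, l) * J $$ (l, Suc k) =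
              (if l = Suc k then J $$ (k, k) * P $$ (i, Suc k) else 0) +
              (if l = k then J $$ (k, Suc k) * P $$ (i, k) else 0)"
            using bidiagonal[of l "Suc k"] less.prems diag by (cases "l = k"; cases "l = Suc k") auto
        qed
        then show ?thesis
          using less.prems by (simp add: sum.distrib)
      qed
      then have gen: "(\<Sum>j<n. A $$ (i, j) * P $$ (j, Suc k)) =
          J $$ (k, k) * P $$ (i, Suc k) + J $$ (k, Suc k) * P $$ (i, k)" if "i < n" for i
        using column[of i "Suc k"] that less.prems by simp
      have "J $$ (k, Suc k) = 0"
        by (rule hermitian_no_generalized_eigenvector[OF A(2) eig gen column_nonzero]) (use less.prems in auto)
      with nz show False ..
    qed
  qed
  have "J $$ (i, j) = 0" if "i < n" "j < n" "i \<noteq> j" for i j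
    using bidiagonal[of i j] superdiagonal[of i] that by auto
  with wit show ?thesis
    by (intro that[of J P Q])
qed

text \<open>The functionals are the coordinates that belong to the negative eigenvalues in an
  eigenvector basis. The basis need not be orthonormal: eigenvectors of distinct eigenvalues are
  orthogonal, and this suffices to see that the form is a sum of squares when these coordinates
  vanish.\<close>

lemma hermitian_nonneg_modulo:
  assumes A: "A \<in> carrier_mat n n" "hermitian_entries n A"
  shows "\<exists>u. \<forall>c. (\<forall>k<negative_eigenvalue_count A. (\<Sum>i<n. u k i * c i) = 0) \<longrightarrow>
    0 \<le> Re (\<Sum>i<n. \<Sum>j<n. c i * cnj (c j) * A $$ (i, j))"
proof -
  obtain J P Q where J: "J \<in> carrier_mat n n" and P: "P \<in> carrier_mat n n" and Q: "Q \<in> carrier_mat n n"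
    and A_eq: "A = P * J * Q" and PQ: "P * Q = 1\<^sub>m n" and QP: "Q * P = 1\<^sub>m n"
    and diagonal: "\<And>i j. i < n \<Longrightarrow> j < n \<Longrightarrow> i \<noteq> j \<Longrightarrow> J $$ (i, j) = 0"
    using hermitian_similar_diagonal[OF A] by metis
  have sim: "similar_mat A J"
    by (rule similar_matI[of _ _ P Q n]) (use A J P Q A_eq PQ QP in auto)
  define D where "D k = J $$ (k, k)" for k
  have eig: "(\<Sum>j<n. A $$ (i, j) * P $$ (j, k)) = D k * P $$ (i, k)" if "i < n" "k < n" for i k
  proof -
    have "(\<Sum>j<n. A $$ (i, j) * P $$ (j, k)) = (\<Sum>l<n. P $$ (i, l) * J $$ (l, k))"
      by (rule similar_matrix_columns[OF J P Q A_eq QP that])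
    also have "\<dots> = (\<Sum>l<n. if l = k then D k * P $$ (i, k) else 0)"
      using diagonal that by (intro sum.cong) (auto simp: D_def)
    finally show ?thesis
      using that by simp
  qed
  have D_real: "D k \<in> \<real>" if "k < n" for k
    by (rule hermitian_eigenvalue_real[OF A(2) eig left_invertible_column_nonzero[OF P Q QP]])
       (use that in auto)
  \<comment> \<open>The Gram matrix of the eigenvectors.\<close>
  define G where "G k l = (\<Sum>i<n. P $$ (i, k) * cnj (P $$ (i, l)))" for k l
  have orthogonal: "G k l = 0" if "k < n" "l < n" "D k \<noteq> D l" for k l
  proof -
    have "(\<Sum>i<n. D k * P $$ (i, k) * cnj (P $$ (i, l))) = (\<Sum>i<n. P $$ (i, k) * cnj (D l * P $$ (i, l)))"
      using hermitian_adjoint[OF A(2), of "\<lambda>i. P $$ (i, k)" "\<lambda>i. P $$ (i, l)"] that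
      by (simp add: eig)
    then have "D k * G k l = cnj (D l) * G k l"
      by (simp add: G_def sum_distrib_left mult_ac)
    then show ?thesis
      using D_real[OF that(2)] that(3) by (simp add: Reals_cnj_iff)
  qed
  define S where "S = {k. k < n \<and> D k \<in> \<real> \<and> Re (D k) < 0}"
  have count: "negative_eigenvalue_count A = card S"
    unfolding S_def D_def
    by (rule negative_eigenvalue_count_similar_diagonal[OF A(1) J _ sim])
       (use J diagonal in auto)
  have "finite S"
    by (simp add: S_def)
  then obtain e where e: "bij_betw e {..<card S} S"
    using ex_bij_betw_nat_finite[of S] by (auto simp: atLeast0LessThan)
  \<comment> \<open>Coordinates of the conjugate of \<open>c\<close> in the eigenvector basis; the conjugate enters because
    \<open>c\<close> itself multiplies the row index in the form.\<close>
  define z where "z c k = (\<Sum>i<n. Q $$ (k, i) * cnj (c i))" for c k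
  have expand: "cnj (c i) = (\<Sum>k<n. P $$ (i, k) * z c k)" if "i < n" for c i
  proof -
    have delta: "(\<Sum>k<n. P $$ (i, k) * Q $$ (k, j)) = (if i = j then 1 else 0)" if "j < n" for j
      using arg_cong[OF PQ, of "\<lambda>M. M $$ (i, j)"] P Q that \<open>i < n\<close>
      by (simp add: scalar_prod_def atLeast0LessThan)
    have "(\<Sum>k<n. P $$ (i, k) * z c k) = (\<Sum>k<n. \<Sum>j<n. P $$ (i, k) * Q $$ (k, j) * cnj (c j))"
      by (simp add: z_def sum_distrib_left mult.assoc)
    also have "\<dots> = (\<Sum>j<n. (\<Sum>k<n. P $$ (i, k) * Q $$ (k, j)) * cnj (c j))"
      by (subst sum.swap) (simp add: sum_distrib_right)
    also have "\<dots> = (\<Sum>j<n. if j = i then cnj (c j) else 0)"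
      by (intro sum.cong) (auto simp: delta)
    finally show ?thesis
      using that by simp
  qed
  have nonneg: "0 \<le> Re (\<Sum>i<n. \<Sum>j<n. c i * cnj (c j) * A $$ (i, j))"
    if orth: "\<And>k. k \<in> S \<Longrightarrow> z c k = 0" for c
  proof -
    \<comment> \<open>Where \<open>G k l\<close> and both coordinates are nonzero the two eigenvalues agree and are
      nonnegative, so \<open>D k\<close> can be split symmetrically as \<open>s k * cnj (s l)\<close>.\<close>
    define s where "s k = complex_of_real (sqrt (Re (D k)))" for k
    have s: "z c k * cnj (z c l) * D k * G k l = z c k * cnj (z c l) * (s k * cnj (s l)) * G k l"
      if "k < n" "l < n" for k l
    proof (cases "z c k = 0 \<or> D k \<noteq> D l")
      case True
      then show ?thesis
        using orthogonal that by auto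
    next
      case False
      then have "k \<notin> S" and D_eq: "D l = D k"
        using orth[of k] by auto
      then have "Re (D k) \<ge> 0"
        using D_real[OF that(1)] that by (simp add: S_def)
      then have "s k * cnj (s l) = D k"
        using D_real[OF that(1)] D_eq by (simp add: s_def complex_is_Real_iff complex_eq_iff flip: of_real_mult)
      then show ?thesis
        by simp
    qed
    have "(\<Sum>i<n. \<Sum>j<n. c i * cnj (c j) * A $$ (i, j)) =
        (\<Sum>i<n. c i * (\<Sum>j<n. \<Sum>k<n. z c k * (A $$ (i, j) * P $$ (j, k))))"
      by (simp add: expand[where c = c] sum_distrib_left sum_distrib_right mult_ac)
    also have "\<dots> = (\<Sum>i<n. c i * (\<Sum>k<n. z c k * (\<Sum>j<n. A $$ (i, j) * P $$ (j, k))))"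
      unfolding sum_distrib_left by (rule sum.cong[OF refl], rule sum.swap)
    also have "\<dots> = (\<Sum>i<n. c i * (\<Sum>k<n. z c k * (D k * P $$ (i, k))))"
      by (simp add: eig)
    also have "\<dots> = (\<Sum>i<n. \<Sum>l<n. \<Sum>k<n. z c k * cnj (z c l) * D k * (P $$ (i, k) * cnj (P $$ (i, l))))"
    proof (intro sum.cong refl)
      fix i assume "i \<in> {..<n}"
      then have "c i = (\<Sum>l<n. cnj (P $$ (i, l)) * cnj (z c l))"
        using arg_cong[OF expand[of i c], of cnj] by (simp add: cnj_sum)
      then show "c i * (\<Sum>k<n. z c k * (D k * P $$ (i, k))) =
          (\<Sum>l<n. \<Sum>k<n. z c k * cnj (z c l) * D k * (P $$ (i, k) * cnj (P $$ (i, l))))"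
        by (simp add: sum_product mult_ac)
    qed
    also have "\<dots> = (\<Sum>l<n. \<Sum>k<n. z c k * cnj (z c l) * D k * G k l)"
      unfolding G_def sum_distrib_left
      by (rule trans[OF sum.swap], rule sum.cong[OF refl], rule sum.swap)
    also have "\<dots> = (\<Sum>l<n. \<Sum>k<n. z c k * cnj (z c l) * (s k * cnj (s l)) * G k l)"
      by (intro sum.cong refl s) auto
    also have "\<dots> = (\<Sum>i<n. \<Sum>l<n. \<Sum>k<n. z c k * cnj (z c l) * (s k * cnj (s l)) * (P $$ (i, k) * cnj (P $$ (i, l))))"
      unfolding G_def sum_distrib_left
      by (rule sym, rule trans[OF sum.swap], rule sum.cong[OF refl], rule sum.swap)
    also have "\<dots> = (\<Sum>i<n. cnj (\<Sum>l<n. z c l * s l * P $$ (i, l)) * (\<Sum>k<n. z c k * s k * P $$ (i, k)))"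
      unfolding cnj_sum sum_product by (intro sum.cong refl) (simp add: mult_ac)
    also have "Re \<dots> \<ge> 0"
    proof -
      have "0 \<le> Re (cnj w * w)" for w
        by simp
      then show ?thesis
        unfolding Re_sum by (intro sum_nonneg)
    qed
    finally show ?thesis .
  qed
  show ?thesis
  proof (intro exI allI impI)
    fix c
    assume 0: "\<forall>k<negative_eigenvalue_count A. (\<Sum>i<n. cnj (Q $$ (e k, i)) * c i) = 0"
    show "0 \<le> Re (\<Sum>i<n. \<Sum>j<n. c i * cnj (c j) * A $$ (i, j))"
    proof (rule nonneg)
      fix k assume "k \<in> S"
      then obtain m where "m < card S" "e m = k"
        using e unfolding bij_betw_def by (metis imageE lessThan_iff)
      then have "(\<Sum>i<n. cnj (Q $$ (k, i)) * c i) = 0"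
        using 0 count by auto
      from arg_cong[OF this, of cnj] show "z c k = 0"
        by (simp add: z_def cnj_sum)
    qed
  qed
qed


section \<open>Kernels that are nonnegative modulo finitely many functionals\<close>

text \<open>A form with at most \<open>k\<close> negative squares, described by the codimension of a subspace on
  which it is nonnegative. In contrast to counting eigenvalues, this description passes to sums
  and to changes of variable without further spectral theory.\<close>

definition nonneg_modulo ::
    "nat \<Rightarrow> complex set \<Rightarrow> (complex \<Rightarrow> complex \<Rightarrow> complex) \<Rightarrow> bool" where
  "nonneg_modulo k \<Omega> K \<longleftrightarrow>
     (\<forall>X. finite X \<and> X \<subseteq> \<Omega> \<longrightarrow>
       (\<exists>u :: nat \<Rightarrow> complex \<Rightarrow> complex. \<forall>c. (\<forall>i<k. (\<Sum>x\<in>X. u i x * c x) = 0) \<longrightarrow>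
         0 \<le> Re (\<Sum>x\<in>X. \<Sum>y\<in>X. c x * cnj (c y) * K x y)))"

lemma nonneg_moduloI:
  assumes "\<And>X. finite X \<Longrightarrow> X \<subseteq> \<Omega> \<Longrightarrow> \<exists>u :: nat \<Rightarrow> complex \<Rightarrow> complex.
    \<forall>c. (\<forall>i<k. (\<Sum>x\<in>X. u i x * c x) = 0) \<longrightarrow> 0 \<le> Re (\<Sum>x\<in>X. \<Sum>y\<in>X. c x * cnj (c y) * K x y)"
  shows "nonneg_modulo k \<Omega> K"
  using assms unfolding nonneg_modulo_def by blast

lemma nonneg_moduloE:
  assumes "nonneg_modulo k \<Omega> K" "finite X" "X \<subseteq> \<Omega>"
  obtains u :: "nat \<Rightarrow> complex \<Rightarrow> complex" where "\<And>c. (\<And>i. i < k \<Longrightarrow> (\<Sum>x\<in>X. u i x * c x) = 0) \<Longrightarrow>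
    0 \<le> Re (\<Sum>x\<in>X. \<Sum>y\<in>X. c x * cnj (c y) * K x y)"
proof -
  from assms have "\<exists>u :: nat \<Rightarrow> complex \<Rightarrow> complex. \<forall>c. (\<forall>i<k. (\<Sum>x\<in>X. u i x * c x) = 0) \<longrightarrow>
      0 \<le> Re (\<Sum>x\<in>X. \<Sum>y\<in>X. c x * cnj (c y) * K x y)"
    unfolding nonneg_modulo_def by blast
  then obtain u :: "nat \<Rightarrow> complex \<Rightarrow> complex" where
    u: "\<forall>c. (\<forall>i<k. (\<Sum>x\<in>X. u i x * c x) = 0) \<longrightarrow>
      0 \<le> Re (\<Sum>x\<in>X. \<Sum>y\<in>X. c x * cnj (c y) * K x y)" ..
  show ?thesis
    by (rule that[of u]) (use u in blast)
qed

lemma has_negative_squares_nonneg_modulo: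
  assumes "has_negative_squares \<Omega> K q" "q \<le> k"
  shows "nonneg_modulo k \<Omega> K"
proof (rule nonneg_moduloI)
  fix X assume X: "finite X" "X \<subseteq> \<Omega>"
  define N where "N = card X"
  obtain e where e: "bij_betw e {..<N} X"
    using ex_bij_betw_nat_finite[OF X(1)] by (auto simp: atLeast0LessThan N_def)
  have in_\<Omega>: "e i \<in> \<Omega>" if "i < N" for i
    using e X that by (auto simp: bij_betw_def)
  define A where "A = kernel_matrix K N e"
  have A: "A \<in> carrier_mat N N"
    by (simp add: A_def kernel_matrix_def)
  have entry: "A $$ (i, j) = K (e i) (e j)" if "i < N" "j < N" for i j
    using that by (simp add: A_def kernel_matrix_def)
  have "K z \<zeta> = cnj (K \<zeta> z)" if "z \<in> \<Omega>" "\<zeta> \<in> \<Omega>" for z \<zeta>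
    using assms(1) that unfolding has_negative_squares_def hermitian_kernel_on_def by blast
  then have "hermitian_entries N A"
    unfolding hermitian_entries_def using in_\<Omega> by (metis entry)
  from hermitian_nonneg_modulo[OF A this] obtain u where
    u: "\<And>c. \<forall>k<negative_eigenvalue_count A. (\<Sum>i<N. u k i * c i) = 0 \<Longrightarrow>
      0 \<le> Re (\<Sum>i<N. \<Sum>j<N. c i * cnj (c j) * A $$ (i, j))"
    by blast
  have count: "negative_eigenvalue_count A \<le> k"
    using assms in_\<Omega> unfolding has_negative_squares_def A_def by (meson order_trans)
  define e' where "e' = inv_into {..<N} e"
  have e': "e' (e i) = i" if "i < N" for i
    using e that by (auto simp: e'_def bij_betw_def)
  show "\<exists>u :: nat \<Rightarrow> complex \<Rightarrow> complex. \<forall>c. (\<forall>i<k. (\<Sum>x\<in>X. u i x * c x) = 0) \<longrightarrow>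
      0 \<le> Re (\<Sum>x\<in>X. \<Sum>y\<in>X. c x * cnj (c y) * K x y)"
  proof (intro exI allI impI)
    fix c
    assume 0: "\<forall>i<k. (\<Sum>x\<in>X. u i (e' x) * c x) = 0"
    have "(\<Sum>i<N. u m i * c (e i)) = (\<Sum>x\<in>X. u m (e' x) * c x)" for m
      by (subst sum.reindex_bij_betw[OF e, symmetric]) (simp add: e')
    then have "0 \<le> Re (\<Sum>i<N. \<Sum>j<N. c (e i) * cnj (c (e j)) * A $$ (i, j))"
      using 0 count by (intro u) auto
    also have "(\<Sum>i<N. \<Sum>j<N. c (e i) * cnj (c (e j)) * A $$ (i, j)) =
        (\<Sum>i<N. \<Sum>j<N. c (e i) * cnj (c (e j)) * K (e i) (e j))"
      by (simp add: entry)
    also have "\<dots> = (\<Sum>i<N. \<Sum>y\<in>X. c (e i) * cnj (c y) * K (e i) y)"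
      by (intro sum.cong refl sum.reindex_bij_betw[OF e])
    also have "\<dots> = (\<Sum>x\<in>X. \<Sum>y\<in>X. c x * cnj (c y) * K x y)"
      by (rule sum.reindex_bij_betw[OF e])
    finally show "0 \<le> Re (\<Sum>x\<in>X. \<Sum>y\<in>X. c x * cnj (c y) * K x y)" .
  qed
qed

lemma nonneg_modulo_add:
  assumes "nonneg_modulo k \<Omega> K" "nonneg_modulo l \<Omega> L"
  shows "nonneg_modulo (k + l) \<Omega> (\<lambda>x y. K x y + L x y)"
proof (rule nonneg_moduloI)
  fix X assume X: "finite X" "X \<subseteq> \<Omega>"
  from assms(1) X obtain u where u: "\<And>c. (\<And>i. i < k \<Longrightarrow> (\<Sum>x\<in>X. u i x * c x) = 0) \<Longrightarrow>
      0 \<le> Re (\<Sum>x\<in>X. \<Sum>y\<in>X. c x * cnj (c y) * K x y)"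
    by (rule nonneg_moduloE) blast
  from assms(2) X obtain v where v: "\<And>c. (\<And>i. i < l \<Longrightarrow> (\<Sum>x\<in>X. v i x * c x) = 0) \<Longrightarrow>
      0 \<le> Re (\<Sum>x\<in>X. \<Sum>y\<in>X. c x * cnj (c y) * L x y)"
    by (rule nonneg_moduloE) blast
  show "\<exists>w :: nat \<Rightarrow> complex \<Rightarrow> complex. \<forall>c. (\<forall>i<k + l. (\<Sum>x\<in>X. w i x * c x) = 0) \<longrightarrow>
      0 \<le> Re (\<Sum>x\<in>X. \<Sum>y\<in>X. c x * cnj (c y) * (K x y + L x y))"
  proof (intro exI allI impI)
    fix c
    assume 0: "\<forall>i<k + l. (\<Sum>x\<in>X. (if i < k then u i else v (i - k)) x * c x) = 0"
    have "0 \<le> Re (\<Sum>x\<in>X. \<Sum>y\<in>X. c x * cnj (c y) * K x y)"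
    proof (rule u)
      show "(\<Sum>x\<in>X. u i x * c x) = 0" if "i < k" for i
        using 0[rule_format, of i] that by simp
    qed
    moreover have "0 \<le> Re (\<Sum>x\<in>X. \<Sum>y\<in>X. c x * cnj (c y) * L x y)"
    proof (rule v)
      show "(\<Sum>x\<in>X. v i x * c x) = 0" if "i < l" for i
        using 0[rule_format, of "k + i"] that by simp
    qed
    ultimately show "0 \<le> Re (\<Sum>x\<in>X. \<Sum>y\<in>X. c x * cnj (c y) * (K x y + L x y))"
      unfolding distrib_left sum.distrib plus_complex.simps by (rule add_nonneg_nonneg)
  qed
qed

text \<open>A change of variable together with a rescaling \<open>c x \<mapsto> \<omega> x * c x\<close> of the coefficients.
  Restriction of the kernel to a smaller set is the case of the identity map.\<close>

lemma nonneg_modulo_pullback: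
  assumes K: "nonneg_modulo k \<Omega> K" and \<phi>: "inj_on \<phi> \<Omega>'" "\<phi> ` \<Omega>' \<subseteq> \<Omega>"
    and L: "\<And>x y. x \<in> \<Omega>' \<Longrightarrow> y \<in> \<Omega>' \<Longrightarrow> L x y = \<omega> x * cnj (\<omega> y) * K (\<phi> x) (\<phi> y)"
  shows "nonneg_modulo k \<Omega>' L"
proof (rule nonneg_moduloI)
  fix X assume X: "finite X" "X \<subseteq> \<Omega>'"
  then have "finite (\<phi> ` X)" "\<phi> ` X \<subseteq> \<Omega>"
    using \<phi> by auto
  with K obtain u where u: "\<And>c. (\<And>i. i < k \<Longrightarrow> (\<Sum>x\<in>\<phi> ` X. u i x * c x) = 0) \<Longrightarrow>
      0 \<le> Re (\<Sum>x\<in>\<phi> ` X. \<Sum>y\<in>\<phi> ` X. c x * cnj (c y) * K x y)"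
    by (rule nonneg_moduloE) blast
  have inj: "inj_on \<phi> X"
    using \<phi>(1) X(2) by (rule inj_on_subset)
  show "\<exists>w :: nat \<Rightarrow> complex \<Rightarrow> complex. \<forall>c. (\<forall>i<k. (\<Sum>x\<in>X. w i x * c x) = 0) \<longrightarrow>
      0 \<le> Re (\<Sum>x\<in>X. \<Sum>y\<in>X. c x * cnj (c y) * L x y)"
  proof (intro exI allI impI)
    fix c
    assume 0: "\<forall>i<k. (\<Sum>x\<in>X. (\<omega> x * u i (\<phi> x)) * c x) = 0"
    define d where "d p = \<omega> (inv_into X \<phi> p) * c (inv_into X \<phi> p)" for p
    have d: "d (\<phi> x) = \<omega> x * c x" if "x \<in> X" for x
      using inj that by (simp add: d_def)
    have "0 \<le> Re (\<Sum>x\<in>\<phi> ` X. \<Sum>y\<in>\<phi> ` X. d x * cnj (d y) * K x y)"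
      using 0 by (intro u) (simp add: sum.reindex[OF inj] d mult_ac)
    also have "(\<Sum>x\<in>\<phi> ` X. \<Sum>y\<in>\<phi> ` X. d x * cnj (d y) * K x y) =
        (\<Sum>x\<in>X. \<Sum>y\<in>X. d (\<phi> x) * cnj (d (\<phi> y)) * K (\<phi> x) (\<phi> y))"
      by (simp add: sum.reindex[OF inj])
    also have "\<dots> = (\<Sum>x\<in>X. \<Sum>y\<in>X. c x * cnj (c y) * L x y)"
    proof (intro sum.cong refl)
      fix x y assume "x \<in> X" "y \<in> X"
      then show "d (\<phi> x) * cnj (d (\<phi> y)) * K (\<phi> x) (\<phi> y) = c x * cnj (c y) * L x y"
        using X(2) by (subst L) (auto simp: d)
    qed
    finally show "0 \<le> Re (\<Sum>x\<in>X. \<Sum>y\<in>X. c x * cnj (c y) * L x y)" .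
  qed
qed

lemma hermitian_form_square:
  "(\<Sum>x\<in>X. \<Sum>y\<in>X. c x * cnj (c y) * (\<Sum>j\<in>J. p j x * cnj (p j y))) =
   (\<Sum>j\<in>J. (\<Sum>x\<in>X. p j x * c x) * cnj (\<Sum>x\<in>X. p j x * c x))"
proof -
  have "(\<Sum>x\<in>X. \<Sum>y\<in>X. c x * cnj (c y) * (\<Sum>j\<in>J. p j x * cnj (p j y))) =
      (\<Sum>x\<in>X. \<Sum>y\<in>X. \<Sum>j\<in>J. p j x * c x * cnj (p j y * c y))"
    unfolding sum_distrib_left by (intro sum.cong refl) (simp add: mult_ac)
  also have "\<dots> = (\<Sum>x\<in>X. \<Sum>j\<in>J. \<Sum>y\<in>X. p j x * c x * cnj (p j y * c y))"
    by (rule sum.cong[OF refl], rule sum.swap)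
  also have "\<dots> = (\<Sum>j\<in>J. \<Sum>x\<in>X. \<Sum>y\<in>X. p j x * c x * cnj (p j y * c y))"
    by (rule sum.swap)
  finally show ?thesis
    unfolding cnj_sum sum_product .
qed

text \<open>Each subtracted square is the square of a linear functional of \<open>c\<close>; these functionals
  remove the negative part.\<close>

lemma nonneg_modulo_difference_of_squares:
  assumes "\<And>x y. x \<in> \<Omega> \<Longrightarrow> y \<in> \<Omega> \<Longrightarrow>
    K x y = (\<Sum>j<r. p j x * cnj (p j y)) - (\<Sum>j<k. q j x * cnj (q j y))"
  shows "nonneg_modulo k \<Omega> K"
proof (rule nonneg_moduloI)
  fix X assume X: "finite X" "X \<subseteq> \<Omega>"
  show "\<exists>u :: nat \<Rightarrow> complex \<Rightarrow> complex. \<forall>c. (\<forall>i<k. (\<Sum>x\<in>X. u i x * c x) = 0) \<longrightarrow>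
      0 \<le> Re (\<Sum>x\<in>X. \<Sum>y\<in>X. c x * cnj (c y) * K x y)"
  proof (intro exI allI impI)
    fix c
    assume 0: "\<forall>i<k. (\<Sum>x\<in>X. q i x * c x) = 0"
    have "(\<Sum>x\<in>X. \<Sum>y\<in>X. c x * cnj (c y) * K x y) =
        (\<Sum>x\<in>X. \<Sum>y\<in>X. c x * cnj (c y) * (\<Sum>j<r. p j x * cnj (p j y))) -
        (\<Sum>x\<in>X. \<Sum>y\<in>X. c x * cnj (c y) * (\<Sum>j<k. q j x * cnj (q j y)))"
      unfolding sum_subtractf[symmetric] right_diff_distrib[symmetric]
      using X(2) assms by (intro sum.cong refl arg_cong2[of _ _ _ _ "(*)"]) auto
    also have "\<dots> = (\<Sum>j<r. (\<Sum>x\<in>X. p j x * c x) * cnj (\<Sum>x\<in>X. p j x * c x))"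
      unfolding hermitian_form_square using 0 by simp
    also have "Re \<dots> \<ge> 0"
    proof -
      have "0 \<le> Re (w * cnj w)" for w
        by simp
      then show ?thesis
        unfolding Re_sum by (intro sum_nonneg)
    qed
    finally show "0 \<le> Re (\<Sum>x\<in>X. \<Sum>y\<in>X. c x * cnj (c y) * K x y)" .
  qed
qed

section \<open>Blaschke products and the kernel of \<open>- g\<close>\<close>

lemma upper_half_plane_diff_cnj_nonzero:
  assumes "z \<in> upper_half_plane" "w \<in> upper_half_plane"
  shows "z - cnj w \<noteq> 0"
  using assms by (auto simp: upper_half_plane_def complex_eq_iff)

lemma blaschke_factor_kernel:
  assumes "a \<in> upper_half_plane" "z \<in> upper_half_plane" "w \<in> upper_half_plane"
  shows "(1 - (z - a) / (z - cnj a) * cnj ((w - a) / (w - cnj a))) * (\<i> / (z - cnj w)) =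
    (complex_of_real (sqrt (2 * Im a)) / (z - cnj a)) * cnj (complex_of_real (sqrt (2 * Im a)) / (w - cnj a))"
proof -
  have nz: "z - cnj a \<noteq> 0" "w - cnj a \<noteq> 0" "cnj w - a \<noteq> 0" "z - cnj w \<noteq> 0"
    using upper_half_plane_diff_cnj_nonzero[of z a] upper_half_plane_diff_cnj_nonzero[of w a]
      upper_half_plane_diff_cnj_nonzero[of a w] upper_half_plane_diff_cnj_nonzero[of z w] assms
    by auto
  have fraction: "(1 - p / A * (q / B)) * (\<i> / C) = (A * B - p * q) * \<i> / (A * B * C)"
    if "A \<noteq> 0" "B \<noteq> 0" for p q A B C :: complex
    using that by (simp add: divide_simps)
  have cancel: "2 * \<i> * t * (- C) * \<i> / (A * B * C) = 2 * t / (A * B)"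
    if "C \<noteq> 0" for t A B C :: complex
  proof -
    have "2 * \<i> * t * (- C) * \<i> = (2 * t) * C"
      by (simp add: mult_ac)
    then show ?thesis
      unfolding \<open>2 * \<i> * t * (- C) * \<i> = (2 * t) * C\<close> using that by simp
  qed
  have "(1 - (z - a) / (z - cnj a) * cnj ((w - a) / (w - cnj a))) * (\<i> / (z - cnj w)) =
      ((z - cnj a) * (cnj w - a) - (z - a) * (cnj w - cnj a)) * \<i> / ((z - cnj a) * (cnj w - a) * (z - cnj w))"
    using fraction[OF nz(1,3)] by simp
  also have "((z - cnj a) * (cnj w - a) - (z - a) * (cnj w - cnj a)) = (a - cnj a) * (- (z - cnj w))"
    by (simp add: algebra_simps)
  also have "a - cnj a = 2 * \<i> * complex_of_real (Im a)"
    by (simp add: complex_eq_iff)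
  also have "2 * \<i> * complex_of_real (Im a) * (- (z - cnj w)) * \<i> / ((z - cnj a) * (cnj w - a) * (z - cnj w)) =
      complex_of_real (2 * Im a) / ((z - cnj a) * (cnj w - a))"
    using cancel[OF nz(4)] by simp
  also have "complex_of_real (2 * Im a) =
      complex_of_real (sqrt (2 * Im a)) * complex_of_real (sqrt (2 * Im a))"
    using assms(1) by (simp add: upper_half_plane_def flip: of_real_mult)
  finally show ?thesis
    by simp
qed

text \<open>Multiplying a product \<open>B\<close> by one more factor \<open>\<beta>\<close> changes \<open>1 - B z * cnj (B w)\<close> by
  \<open>B z * cnj (B w) * (1 - \<beta> z * cnj (\<beta> w))\<close>, so the kernels of the single factors add up, each
  multiplied by the preceding partial product (the Takenaka--Malmquist system).\<close>

lemma blaschke_kernel_sum_of_squares: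
  assumes "b \<in> blaschke_products k"
  obtains e :: "nat \<Rightarrow> complex \<Rightarrow> complex"
    where "\<And>z w. z \<in> upper_half_plane \<Longrightarrow> w \<in> upper_half_plane \<Longrightarrow>
      (1 - b z * cnj (b w)) * (\<i> / (z - cnj w)) = (\<Sum>j<k. e j z * cnj (e j w))"
proof -
  obtain a where a: "\<forall>j\<in>{1..k}. a j \<in> upper_half_plane"
    and b: "\<forall>z\<in>upper_half_plane. b z = (\<Prod>j=1..k. (z - a j) / (z - cnj (a j)))"
    using assms unfolding blaschke_products_def by blast
  define \<beta> where "\<beta> j z = (z - a j) / (z - cnj (a j))" for j z
  define B where "B q z = (\<Prod>j=1..q. \<beta> j z)" for q z
  define s where "s j z = complex_of_real (sqrt (2 * Im (a j))) / (z - cnj (a j))" for j z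
  have "(1 - B q z * cnj (B q w)) * (\<i> / (z - cnj w)) =
      (\<Sum>j<q. (B j z * s (Suc j) z) * cnj (B j w * s (Suc j) w))"
    if "q \<le> k" "z \<in> upper_half_plane" "w \<in> upper_half_plane" for q z w
    using that(1)
  proof (induction q)
    case (Suc q)
    have factor: "(1 - \<beta> (Suc q) z * cnj (\<beta> (Suc q) w)) * (\<i> / (z - cnj w)) = s (Suc q) z * cnj (s (Suc q) w)"
      unfolding \<beta>_def s_def by (rule blaschke_factor_kernel) (use a Suc.prems that in auto)
    have "B (Suc q) x = B q x * \<beta> (Suc q) x" for x
      by (simp add: B_def)
    then have "(1 - B (Suc q) z * cnj (B (Suc q) w)) * (\<i> / (z - cnj w)) =
        (1 - B q z * cnj (B q w)) * (\<i> / (z - cnj w)) +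
        B q z * cnj (B q w) * ((1 - \<beta> (Suc q) z * cnj (\<beta> (Suc q) w)) * (\<i> / (z - cnj w)))"
      by (simp add: algebra_simps)
    then show ?case
      unfolding factor Suc.IH[OF Suc_leD[OF Suc.prems]] by (simp add: mult_ac)
  qed (simp add: B_def)
  then have "(1 - b z * cnj (b w)) * (\<i> / (z - cnj w)) =
      (\<Sum>j<k. (B j z * s (Suc j) z) * cnj (B j w * s (Suc j) w))"
    if "z \<in> upper_half_plane" "w \<in> upper_half_plane" for z w
    using that b unfolding B_def \<beta>_def by simp
  then show ?thesis
    by (rule that)
qed

text \<open>With \<open>v = sqrt 2 / (b2 - b1)\<close> the kernel of \<open>- g\<close> is \<open>v z * cnj (v w)\<close> times the
  Blaschke kernel of \<open>b2\<close> minus that of \<open>b1\<close>; only the latter contributes negative squares.\<close>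

lemma nonneg_modulo_minus_blaschke_quotient:
  assumes b: "b1 \<in> blaschke_products l" "b2 \<in> blaschke_products r"
    and \<Omega>: "\<Omega> \<subseteq> {z \<in> upper_half_plane. b2 z \<noteq> b1 z}"
    and g: "\<And>z. z \<in> \<Omega> \<Longrightarrow> g z = \<i> * ((b2 z + b1 z) / (b2 z - b1 z))"
  shows "nonneg_modulo l \<Omega> (nevanlinna_kernel (\<lambda>z. - g z))"
proof -
  obtain e1 where e1: "\<And>z w. z \<in> upper_half_plane \<Longrightarrow> w \<in> upper_half_plane \<Longrightarrow>
      (1 - b1 z * cnj (b1 w)) * (\<i> / (z - cnj w)) = (\<Sum>j<l. e1 j z * cnj (e1 j w))"
    by (rule blaschke_kernel_sum_of_squares[OF b(1)]) blast
  obtain e2 where e2: "\<And>z w. z \<in> upper_half_plane \<Longrightarrow> w \<in> upper_half_plane \<Longrightarrow>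
      (1 - b2 z * cnj (b2 w)) * (\<i> / (z - cnj w)) = (\<Sum>j<r. e2 j z * cnj (e2 j w))"
    by (rule blaschke_kernel_sum_of_squares[OF b(2)]) blast
  define v where "v z = complex_of_real (sqrt 2) / (b2 z - b1 z)" for z
  have sqrt2: "complex_of_real (sqrt 2) * complex_of_real (sqrt 2) = 2"
    by (simp flip: of_real_mult)
  have "nevanlinna_kernel (\<lambda>z. - g z) z w =
      (\<Sum>j<r. (v z * e2 j z) * cnj (v w * e2 j w)) - (\<Sum>j<l. (v z * e1 j z) * cnj (v w * e1 j w))"
    if "z \<in> \<Omega>" "w \<in> \<Omega>" for z w
  proof -
    have z: "z \<in> upper_half_plane" "b2 z - b1 z \<noteq> 0" and w: "w \<in> upper_half_plane" "b2 w - b1 w \<noteq> 0"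
      using that \<Omega> by auto
    have fraction: "- (\<i> * ((B + A) / (B - A))) - \<i> * ((D + C) / (D - C)) =
        2 * \<i> * (A * C - B * D) / ((B - A) * (D - C))" if "B - A \<noteq> 0" "D - C \<noteq> 0" for A B C D :: complex
    proof -
      have "(B + A) / (B - A) + (D + C) / (D - C) =
          ((B + A) * (D - C) + (D + C) * (B - A)) / ((B - A) * (D - C))"
        using that by (rule add_frac_eq)
      also have "(B + A) * (D - C) + (D + C) * (B - A) = - (2 * (A * C - B * D))"
        by (simp add: algebra_simps)
      finally have sum: "(B + A) / (B - A) + (D + C) / (D - C) =
          - (2 * (A * C - B * D)) / ((B - A) * (D - C))" .
      have "- (\<i> * ((B + A) / (B - A))) - \<i> * ((D + C) / (D - C)) =
          - \<i> * ((B + A) / (B - A) + (D + C) / (D - C))"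
        by (simp only: distrib_left) simp
      moreover have "- \<i> * (- (2 * S) / T) = 2 * \<i> * S / T" for S T
        by simp
      ultimately show ?thesis
        by (simp only: sum)
    qed
    have "cnj (b2 w) - cnj (b1 w) \<noteq> 0"
      using w(2) unfolding complex_cnj_diff[symmetric] complex_cnj_zero_iff .
    then have "- g z - cnj (- g w) =
        2 * \<i> * (b1 z * cnj (b1 w) - b2 z * cnj (b2 w)) / ((b2 z - b1 z) * (cnj (b2 w) - cnj (b1 w)))"
      using fraction[OF z(2), of "cnj (b2 w)" "cnj (b1 w)"] by (simp add: g that)
    also have "\<dots> = (v z * cnj (v w)) * ((1 - b2 z * cnj (b2 w)) - (1 - b1 z * cnj (b1 w))) * \<i>"
    proof -
      have "v z * cnj (v w) = 2 / ((b2 z - b1 z) * (cnj (b2 w) - cnj (b1 w)))"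
        using sqrt2 by (simp add: v_def)
      then show ?thesis
        by (simp add: mult_ac)
    qed
    finally have diff: "- g z - cnj (- g w) =
        (v z * cnj (v w)) * ((1 - b2 z * cnj (b2 w)) - (1 - b1 z * cnj (b1 w))) * \<i>" .
    have "V * (S - T) * \<i> / C = V * (S * (\<i> / C) - T * (\<i> / C))" for V S T C
      by (simp add: divide_inverse algebra_simps)
    then have "nevanlinna_kernel (\<lambda>z. - g z) z w =
        (v z * cnj (v w)) * ((1 - b2 z * cnj (b2 w)) * (\<i> / (z - cnj w)) - (1 - b1 z * cnj (b1 w)) * (\<i> / (z - cnj w)))"
      unfolding nevanlinna_kernel_def diff .
    also have "\<dots> = v z * cnj (v w) * (\<Sum>j<r. e2 j z * cnj (e2 j w)) - v z * cnj (v w) * (\<Sum>j<l. e1 j z * cnj (e1 j w))"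
      unfolding e1[OF z(1) w(1)] e2[OF z(1) w(1)] by (rule right_diff_distrib)
    finally show ?thesis
      by (simp add: sum_distrib_left mult_ac)
  qed
  then show ?thesis
    by (rule nonneg_modulo_difference_of_squares)
qed

section \<open>Moving infinity to the origin\<close>

lemma inversion_upper_half_plane_iff:
  "complex_of_real \<mu> - 1 / z \<in> upper_half_plane \<longleftrightarrow> z \<in> upper_half_plane"
proof (cases "z = 0")
  case False
  then have "(Re z)\<^sup>2 + (Im z)\<^sup>2 > 0"
    by (simp add: complex_neq_0)
  then show ?thesis
    by (simp add: upper_half_plane_def Im_divide zero_less_divide_iff)
qed (simp add: upper_half_plane_def)

text \<open>The inversion satisfies \<open>\<phi> x - cnj (\<phi> y) = (x - cnj y) / (x * cnj y)\<close>, so the two kernels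
  differ by the factor \<open>1 / (x * cnj y)\<close>, which a rescaling of the coefficients absorbs.\<close>

lemma nonneg_modulo_inversion:
  fixes \<mu> :: real
  defines "\<phi> \<equiv> \<lambda>z. complex_of_real \<mu> - 1 / z"
  assumes "nonneg_modulo k \<Omega> (nevanlinna_kernel f)" "\<Omega> \<subseteq> upper_half_plane"
  shows "nonneg_modulo k {z. \<phi> z \<in> \<Omega>} (nevanlinna_kernel (\<lambda>z. f (\<phi> z)))"
proof (rule nonneg_modulo_pullback[OF assms(2), where \<phi> = \<phi> and \<omega> = "\<lambda>z. 1 / z"])
  show "inj_on \<phi> {z. \<phi> z \<in> \<Omega>}"
    by (auto simp: inj_on_def \<phi>_def)
  fix x y assume "x \<in> {z. \<phi> z \<in> \<Omega>}" "y \<in> {z. \<phi> z \<in> \<Omega>}"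
  then have "\<phi> x \<in> upper_half_plane" "\<phi> y \<in> upper_half_plane"
    using assms(3) by auto
  then have xy: "x \<in> upper_half_plane" "y \<in> upper_half_plane"
    unfolding \<phi>_def by (simp_all only: inversion_upper_half_plane_iff)
  then have nz: "x \<noteq> 0" "cnj y \<noteq> 0" "x - cnj y \<noteq> 0"
    using upper_half_plane_diff_cnj_nonzero[of x y] by (auto simp: upper_half_plane_def)
  then have "\<phi> x - cnj (\<phi> y) = (x - cnj y) / (x * cnj y)"
    by (simp add: \<phi>_def field_simps)
  then show "nevanlinna_kernel (\<lambda>z. f (\<phi> z)) x y =
      1 / x * cnj (1 / y) * nevanlinna_kernel f (\<phi> x) (\<phi> y)"
    using nz by (simp add: nevanlinna_kernel_def)
qed auto

section \<open>Linear systems, partial fractions and interpolation\<close>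

text \<open>Gaussian elimination: an unknown with nonzero coefficient in the last equation is eliminated
  together with that equation.\<close>

lemma homogeneous_system_nontrivial_solution:
  fixes A :: "nat \<Rightarrow> 'a \<Rightarrow> complex"
  assumes "finite W" "k < card W"
  shows "\<exists>y. (\<exists>w\<in>W. y w \<noteq> 0) \<and> (\<forall>i<k. (\<Sum>w\<in>W. A i w * y w) = 0)"
  using assms
proof (induction k arbitrary: W A)
  case 0
  then obtain w where "w \<in> W"
    by fastforce
  then show ?case
    by (intro exI[of _ "\<lambda>_. 1"]) auto
next
  case (Suc k)
  show ?case
  proof (cases "\<forall>w\<in>W. A k w = 0")
    case True
    obtain y where "\<exists>w\<in>W. y w \<noteq> 0" "\<forall>i<k. (\<Sum>w\<in>W. A i w * y w) = 0"
      using Suc.IH[of W A] Suc.prems by auto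
    then show ?thesis
      using True by (intro exI[of _ y]) (auto simp: less_Suc_eq)
  next
    case False
    then obtain p where p: "p \<in> W" "A k p \<noteq> 0"
      by blast
    define W' where "W' = W - {p}"
    have W: "W = insert p W'" "p \<notin> W'" "finite W'" "k < card W'"
      using p Suc.prems by (auto simp: W'_def)
    define A' where "A' i w = A i w - A i p * A k w / A k p" for i w
    obtain y where y: "\<exists>w\<in>W'. y w \<noteq> 0" "\<forall>i<k. (\<Sum>w\<in>W'. A' i w * y w) = 0"
      using Suc.IH[of W' A'] W by blast
    define y' where "y' = y(p := - (\<Sum>w\<in>W'. A k w * y w) / A k p)"
    have y'_eq: "y' w = y w" if "w \<in> W'" for w
      using that W(2) by (auto simp: y'_def)
    have sum: "(\<Sum>w\<in>W. A i w * y' w) = (\<Sum>w\<in>W'. A i w * y w) - A i p * (\<Sum>w\<in>W'. A k w * y w) / A k p" for i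
    proof -
      have "(\<Sum>w\<in>W. A i w * y' w) = A i p * y' p + (\<Sum>w\<in>W'. A i w * y' w)"
        using W by simp
      also have "(\<Sum>w\<in>W'. A i w * y' w) = (\<Sum>w\<in>W'. A i w * y w)"
        by (intro sum.cong refl) (simp add: y'_eq)
      finally show ?thesis
        by (simp add: y'_def)
    qed
    have "(\<Sum>w\<in>W'. A' i w * y w) = (\<Sum>w\<in>W. A i w * y' w)" for i
      unfolding sum A'_def by (simp add: left_diff_distrib sum_subtractf sum_distrib_left sum_divide_distrib mult.assoc)
    then have "(\<Sum>w\<in>W. A i w * y' w) = 0" if "i < Suc k" for i
      using y(2) that p(2) sum[of k] by (cases "i = k") (auto simp: less_Suc_eq)
    moreover have "\<exists>w\<in>W. y' w \<noteq> 0"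
      using y(1) y'_eq W(1) by auto
    ultimately show ?thesis
      by blast
  qed
qed

lemma poly_zero_if_many_roots:
  fixes p :: "complex poly"
  assumes "finite Z" "degree p < card Z" "\<And>z. z \<in> Z \<Longrightarrow> poly p z = 0"
  shows "p = 0"
proof (rule ccontr)
  assume "p \<noteq> 0"
  then have "card Z \<le> card {x. poly p x = 0}"
    using assms(3) by (intro card_mono poly_roots_finite) auto
  also have "\<dots> \<le> degree p"
    using \<open>p \<noteq> 0\<close> by (rule card_poly_roots_bound)
  finally show False
    using assms(2) by simp
qed

lemma degree_prod_linear_le:
  "finite Z \<Longrightarrow> degree (\<Prod>z\<in>Z. [:- z, 1:]) \<le> card (Z :: complex set)"
proof (induction Z rule: finite_induct)
  case (insert x Z)
  then show ?case
    using degree_mult_le[of "[:- x, 1:]" "\<Prod>z\<in>Z. [:- z, 1:]"] by (simp del: mult_pCons_left)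
qed simp

text \<open>After multiplication by the denominator this is Lagrange interpolation of \<open>q\<close> at the
  nodes \<open>Z\<close>.\<close>

lemma partial_fractions_simple_poles:
  fixes q :: "complex poly"
  assumes Z: "finite Z" and deg: "degree q < card Z" and x: "x \<notin> Z"
  shows "(\<Sum>z\<in>Z. poly q z / (\<Prod>z'\<in>Z - {z}. z - z') / (x - z)) = poly q x / (\<Prod>z\<in>Z. x - z)"
proof -
  define c where "c z = poly q z / (\<Prod>z'\<in>Z - {z}. z - z')" for z
  define L where "L z = (\<Prod>z'\<in>Z - {z}. [:- z', 1:])" for z
  define R where "R = (\<Sum>z\<in>Z. Polynomial.smult (c z) (L z)) - q"
  have poly_L: "poly (L z) x = (\<Prod>z'\<in>Z - {z}. x - z')" for z x
    by (simp add: L_def poly_prod)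
  have "R = 0"
  proof (rule poly_zero_if_many_roots[OF Z])
    have "degree (Polynomial.smult (c z) (L z)) < card Z" if "z \<in> Z" for z
    proof -
      have "degree (Polynomial.smult (c z) (L z)) \<le> card (Z - {z})"
        unfolding L_def by (rule order_trans[OF degree_smult_le degree_prod_linear_le]) (use Z in auto)
      also have "\<dots> < card Z"
        using Z that by (intro psubset_card_mono) auto
      finally show ?thesis .
    qed
    moreover have "0 < card Z"
      using deg by linarith
    ultimately have "degree (\<Sum>z\<in>Z. Polynomial.smult (c z) (L z)) < card Z"
      by (intro degree_sum_less) auto
    then show "degree R < card Z"
      unfolding R_def using deg by (rule degree_diff_less)
    fix w assume w: "w \<in> Z"
    have "poly (L z) w = 0" if "z \<in> Z - {w}" for z
      using that Z w by (auto simp: poly_L prod_zero_iff)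
    then have "poly (\<Sum>z\<in>Z. Polynomial.smult (c z) (L z)) w = c w * poly (L w) w"
      using Z w by (simp add: poly_sum sum.remove[of Z w])
    also have "\<dots> = poly q w"
      using Z by (simp add: poly_L c_def prod_zero_iff)
    finally show "poly R w = 0"
      by (simp add: R_def)
  qed
  then have "q = (\<Sum>z\<in>Z. Polynomial.smult (c z) (L z))"
    by (simp add: R_def)
  then have "poly q x = (\<Sum>z\<in>Z. c z * poly (L z) x)"
    by (simp add: poly_sum)
  also have "\<dots> = (\<Sum>z\<in>Z. c z / (x - z) * (\<Prod>z\<in>Z. x - z))"
  proof (intro sum.cong refl)
    fix z assume z: "z \<in> Z"
    have "(\<Prod>z\<in>Z. x - z) = (x - z) * poly (L z) x"
      unfolding poly_L by (rule prod.remove[OF Z z])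
    then show "c z * poly (L z) x = c z / (x - z) * (\<Prod>z\<in>Z. x - z)"
      using x z by auto
  qed
  finally have "poly q x = (\<Sum>z\<in>Z. c z / (x - z)) * (\<Prod>z\<in>Z. x - z)"
    by (simp add: sum_distrib_right)
  moreover have "(\<Prod>z\<in>Z. x - z) \<noteq> 0"
    using Z x by (auto simp: prod_zero_iff)
  ultimately show ?thesis
    by (simp add: c_def)
qed

lemma interpolation_polynomial:
  fixes W :: "complex set"
  assumes W: "finite W" "v \<in> W"
  obtains q where "degree q < card W" "\<And>w. w \<in> W \<Longrightarrow> poly q w = (if w = v then c else 0)"
proof -
  define L where "L = (\<Prod>w\<in>W - {v}. [:- w, 1:])"
  have poly_L: "poly L x = (\<Prod>w\<in>W - {v}. x - w)" for x
    by (simp add: L_def poly_prod)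
  have "poly L v \<noteq> 0"
    using W by (auto simp: poly_L prod_zero_iff)
  show ?thesis
  proof (rule that[of "Polynomial.smult (c / poly L v) L"])
    have "degree (Polynomial.smult (c / poly L v) L) \<le> card (W - {v})"
      unfolding L_def by (rule order_trans[OF degree_smult_le degree_prod_linear_le]) (use W in auto)
    also have "\<dots> < card W"
      using W by (intro psubset_card_mono) auto
    finally show "degree (Polynomial.smult (c / poly L v) L) < card W" .
    show "poly (Polynomial.smult (c / poly L v) L) w = (if w = v then c else 0)" if "w \<in> W" for w
      using \<open>poly L v \<noteq> 0\<close> that W by (auto simp: poly_L prod_zero_iff)
  qed
qed

text \<open>If each entry of \<open>E\<close> deviates from that of \<open>- \<sigma>\<close> times the identity by at most \<open>\<eta>\<close>, the
  form of the deviation is at most \<open>\<eta> * card W\<close> times the squared norm.\<close>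

lemma perturbed_negative_identity_definite:
  fixes E :: "'a \<Rightarrow> 'a \<Rightarrow> complex" and \<sigma> \<eta> :: real
  assumes W: "finite W"
    and near: "\<And>w v. w \<in> W \<Longrightarrow> v \<in> W \<Longrightarrow> cmod (E w v + (if w = v then of_real \<sigma> else 0)) \<le> \<eta>"
    and small: "\<eta> * card W < \<sigma>"
    and y: "\<exists>w\<in>W. y w \<noteq> 0"
  shows "Re (\<Sum>w\<in>W. \<Sum>v\<in>W. y w * cnj (y v) * E w v) < 0"
proof -
  define F where "F w v = E w v + (if w = v then of_real \<sigma> else 0)" for w v
  define s where "s = (\<Sum>w\<in>W. (cmod (y w))\<^sup>2)"
  obtain w0 where w0: "w0 \<in> W" "y w0 \<noteq> 0"
    using y by blast
  have "0 < (cmod (y w0))\<^sup>2"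
    using w0 by simp
  also have "\<dots> \<le> s"
    unfolding s_def using W w0 by (intro member_le_sum) auto
  finally have "s > 0" .
  have "0 \<le> \<eta>"
    using near[OF w0(1) w0(1)] norm_ge_zero order_trans by blast
  have "y w * cnj (y v) * E w v = y w * cnj (y v) * F w v - (if v = w then of_real \<sigma> * (y w * cnj (y w)) else 0)" for w v
    by (simp add: F_def algebra_simps)
  then have "(\<Sum>w\<in>W. \<Sum>v\<in>W. y w * cnj (y v) * E w v) =
      (\<Sum>w\<in>W. \<Sum>v\<in>W. y w * cnj (y v) * F w v) - of_real (\<sigma> * s)"
    using W by (simp add: sum_subtractf s_def sum_distrib_left complex_norm_square[symmetric] del: of_real_power)
  then have "Re (\<Sum>w\<in>W. \<Sum>v\<in>W. y w * cnj (y v) * E w v) =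
      Re (\<Sum>w\<in>W. \<Sum>v\<in>W. y w * cnj (y v) * F w v) - \<sigma> * s"
    by (simp only: minus_complex.simps Re_complex_of_real)
  also have "Re (\<Sum>w\<in>W. \<Sum>v\<in>W. y w * cnj (y v) * F w v) \<le> (\<Sum>w\<in>W. \<Sum>v\<in>W. cmod (y w) * cmod (y v) * \<eta>)"
  proof (rule order_trans[OF complex_Re_le_cmod sum_norm_le], rule sum_norm_le)
    fix w v assume "w \<in> W" "v \<in> W"
    then show "cmod (y w * cnj (y v) * F w v) \<le> cmod (y w) * cmod (y v) * \<eta>"
      using near[of w v] by (simp add: norm_mult F_def mult_left_mono)
  qed
  also have "\<dots> \<le> (\<Sum>w\<in>W. \<Sum>v\<in>W. \<eta> / 2 * (cmod (y w))\<^sup>2 + \<eta> / 2 * (cmod (y v))\<^sup>2)"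
  proof (intro sum_mono)
    fix w v
    have "2 * (cmod (y w) * cmod (y v)) \<le> (cmod (y w))\<^sup>2 + (cmod (y v))\<^sup>2"
      using sum_squares_bound[of "cmod (y w)" "cmod (y v)"] by simp
    from mult_left_mono[OF this, of "\<eta> / 2"] \<open>0 \<le> \<eta>\<close>
    show "cmod (y w) * cmod (y v) * \<eta> \<le> \<eta> / 2 * (cmod (y w))\<^sup>2 + \<eta> / 2 * (cmod (y v))\<^sup>2"
      by (simp add: algebra_simps)
  qed
  also have "\<dots> = \<eta> * card W * s"
  proof -
    have "(\<Sum>v\<in>W. \<eta> / 2 * (cmod (y v))\<^sup>2) = \<eta> / 2 * s"
      by (simp add: s_def sum_distrib_left)
    moreover have "(\<Sum>w\<in>W. real (card W) * (\<eta> / 2 * (cmod (y w))\<^sup>2)) = real (card W) * (\<eta> / 2 * s)"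
      unfolding s_def by (simp only: sum_distrib_left)
    ultimately show ?thesis
      unfolding sum.distrib sum_constant by (simp only:) (simp add: algebra_simps)
  qed
  also have "\<eta> * card W * s - \<sigma> * s < 0"
    using \<open>s > 0\<close> small by (simp flip: left_diff_distrib add: mult_neg_pos)
  finally show ?thesis
    by simp
qed


section \<open>Coefficient vectors as rational functions\<close>

text \<open>The inner sum is the value at \<open>cnj x\<close> of the rational function with simple poles in \<open>X\<close> and
  residues \<open>\<beta>\<close>. In this form, the decay of \<open>f\<close> at the points of \<open>X\<close> can be weighed against the growth of
  residues and values of rational functions whose poles come close to each other.\<close>

definition half_form :: "(complex \<Rightarrow> complex) \<Rightarrow> complex set \<Rightarrow> (complex \<Rightarrow> complex) \<Rightarrow> (complex \<Rightarrow> complex) \<Rightarrow> complex" where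
  "half_form f X \<alpha> \<beta> = (\<Sum>x\<in>X. \<alpha> x * f x * cnj (\<Sum>y\<in>X. \<beta> y / (cnj x - y)))"

text \<open>The two terms of the numerator \<open>f x - cnj (f y)\<close> contribute complex conjugate sums.\<close>

lemma nevanlinna_form_half_form:
  "Re (\<Sum>x\<in>X. \<Sum>y\<in>X. c x * cnj (c y) * nevanlinna_kernel f x y) = 2 * Re (half_form f X c c)"
proof -
  define T where "T x y = c x * cnj (c y) * (f x / (x - cnj y))" for x y
  have "c x * cnj (c y) * nevanlinna_kernel f x y = T x y + cnj (T y x)" for x y
  proof -
    have "cnj (T y x) = c x * cnj (c y) * (cnj (f y) / - (x - cnj y))"
      by (simp add: T_def)
    then show ?thesis
      by (simp only: T_def nevanlinna_kernel_def diff_divide_distrib divide_minus_right) (simp add: algebra_simps)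
  qed
  then have "(\<Sum>x\<in>X. \<Sum>y\<in>X. c x * cnj (c y) * nevanlinna_kernel f x y) =
      (\<Sum>x\<in>X. \<Sum>y\<in>X. T x y) + (\<Sum>x\<in>X. \<Sum>y\<in>X. cnj (T y x))"
    by (simp add: sum.distrib)
  also have "(\<Sum>x\<in>X. \<Sum>y\<in>X. cnj (T y x)) = cnj (\<Sum>x\<in>X. \<Sum>y\<in>X. T x y)"
    unfolding cnj_sum by (rule sum.swap)
  also have "(\<Sum>x\<in>X. \<Sum>y\<in>X. T x y) = half_form f X c c"
    unfolding half_form_def cnj_sum sum_distrib_left
    by (intro sum.cong refl) (simp add: T_def mult_ac)
  finally show ?thesis
    by simp
qed

lemma half_form_linear_combination:
  "half_form f X (\<lambda>x. \<Sum>w\<in>W. y w * \<gamma> w x) (\<lambda>x. \<Sum>w\<in>W. y w * \<gamma> w x) =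
   (\<Sum>w\<in>W. \<Sum>v\<in>W. y w * cnj (y v) * half_form f X (\<gamma> w) (\<gamma> v))"
proof -
  define R where "R v x = cnj (\<Sum>z\<in>X. \<gamma> v z / (cnj x - z))" for v x
  have "cnj (\<Sum>z\<in>X. (\<Sum>v\<in>W. y v * \<gamma> v z) / (cnj x - z)) = (\<Sum>v\<in>W. cnj (y v) * R v x)" for x
  proof -
    have "(\<Sum>z\<in>X. (\<Sum>v\<in>W. y v * \<gamma> v z) / (cnj x - z)) = (\<Sum>z\<in>X. \<Sum>v\<in>W. y v * (\<gamma> v z / (cnj x - z)))"
      by (simp add: sum_divide_distrib)
    also have "\<dots> = (\<Sum>v\<in>W. y v * (\<Sum>z\<in>X. \<gamma> v z / (cnj x - z)))"
      unfolding sum_distrib_left by (rule sum.swap)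
    finally show ?thesis
      by (simp only: R_def cnj_sum complex_cnj_mult)
  qed
  then have "half_form f X (\<lambda>x. \<Sum>w\<in>W. y w * \<gamma> w x) (\<lambda>x. \<Sum>w\<in>W. y w * \<gamma> w x) =
      (\<Sum>x\<in>X. (\<Sum>w\<in>W. y w * \<gamma> w x) * f x * (\<Sum>v\<in>W. cnj (y v) * R v x))"
    unfolding half_form_def by simp
  also have "\<dots> = (\<Sum>x\<in>X. \<Sum>w\<in>W. \<Sum>v\<in>W. y w * cnj (y v) * (\<gamma> w x * f x * R v x))"
    unfolding sum_distrib_right unfolding sum_distrib_left by (intro sum.cong refl) (simp add: mult_ac)
  also have "\<dots> = (\<Sum>w\<in>W. \<Sum>v\<in>W. \<Sum>x\<in>X. y w * cnj (y v) * (\<gamma> w x * f x * R v x))"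
    by (rule trans[OF sum.swap], rule sum.cong[OF refl], rule sum.swap)
  also have "\<dots> = (\<Sum>w\<in>W. \<Sum>v\<in>W. y w * cnj (y v) * half_form f X (\<gamma> w) (\<gamma> v))"
    unfolding half_form_def R_def sum_distrib_left ..
  finally show ?thesis .
qed

text \<open>The \<open>k\<close> functionals impose fewer conditions than there are vectors \<open>\<gamma> w\<close>, so they vanish on a
  nontrivial combination of these vectors, on which the form is negative.\<close>

lemma not_nonneg_modulo_if_negative_gram_matrix:
  fixes \<gamma> :: "'a \<Rightarrow> complex \<Rightarrow> complex" and \<sigma> \<eta> :: real
  assumes K: "nonneg_modulo k \<Omega> (nevanlinna_kernel f)" and X: "finite X" "X \<subseteq> \<Omega>"
    and W: "finite W" "k < card W" and small: "\<eta> * card W < \<sigma>"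
    and gram: "\<And>w v. w \<in> W \<Longrightarrow> v \<in> W \<Longrightarrow>
      cmod (half_form f X (\<gamma> w) (\<gamma> v) + (if w = v then of_real \<sigma> else 0)) \<le> \<eta>"
  shows False
proof -
  from K X obtain u where u: "\<And>c. (\<And>i. i < k \<Longrightarrow> (\<Sum>x\<in>X. u i x * c x) = 0) \<Longrightarrow>
      0 \<le> Re (\<Sum>x\<in>X. \<Sum>y\<in>X. c x * cnj (c y) * nevanlinna_kernel f x y)"
    by (rule nonneg_moduloE) blast
  obtain y where y: "\<exists>w\<in>W. y w \<noteq> 0" "\<forall>i<k. (\<Sum>w\<in>W. (\<Sum>x\<in>X. u i x * \<gamma> w x) * y w) = 0"
    using homogeneous_system_nontrivial_solution[OF W, of "\<lambda>i w. \<Sum>x\<in>X. u i x * \<gamma> w x"] by blast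
  define c where "c x = (\<Sum>w\<in>W. y w * \<gamma> w x)" for x
  have "0 \<le> Re (\<Sum>x\<in>X. \<Sum>y\<in>X. c x * cnj (c y) * nevanlinna_kernel f x y)"
  proof (rule u)
    fix i assume "i < k"
    have "(\<Sum>x\<in>X. u i x * c x) = (\<Sum>x\<in>X. \<Sum>w\<in>W. u i x * \<gamma> w x * y w)"
      unfolding c_def sum_distrib_left by (intro sum.cong refl) (simp add: mult_ac)
    also have "\<dots> = (\<Sum>w\<in>W. (\<Sum>x\<in>X. u i x * \<gamma> w x) * y w)"
      unfolding sum_distrib_right by (rule sum.swap)
    finally show "(\<Sum>x\<in>X. u i x * c x) = 0"
      using y(2) \<open>i < k\<close> by simp
  qed
  then have "0 \<le> Re (half_form f X c c)"
    unfolding nevanlinna_form_half_form by simp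
  moreover have "half_form f X c c = (\<Sum>w\<in>W. \<Sum>v\<in>W. y w * cnj (y v) * half_form f X (\<gamma> w) (\<gamma> v))"
    unfolding c_def by (rule half_form_linear_combination)
  moreover have "Re (\<Sum>w\<in>W. \<Sum>v\<in>W. y w * cnj (y v) * half_form f X (\<gamma> w) (\<gamma> v)) < 0"
    by (rule perturbed_negative_identity_definite[OF W(1) gram small y(1)])
  ultimately show False
    by simp
qed

section \<open>Poles approaching the boundary\<close>

text \<open>The node with index \<open>(j, a)\<close> lies at height \<open>a * t\<close> above the boundary point \<open>lam j\<close>; the
  heights differ so that the nodes of a cluster stay distinct while they approach that point.\<close>

definition cluster_node :: "(nat \<Rightarrow> real) \<Rightarrow> real \<Rightarrow> nat \<times> nat \<Rightarrow> complex" where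
  "cluster_node lam t s = complex_of_real (lam (fst s)) + \<i> * complex_of_real (real (snd s) * t)"

lemma cluster_node_tendsto:
  "((\<lambda>t. cluster_node lam t s) \<longlongrightarrow> complex_of_real (lam (fst s))) (at_right 0)"
  unfolding cluster_node_def by (auto intro!: tendsto_eq_intros)

text \<open>A factor that belongs to a node of the cluster of \<open>lam j\<close> is exactly proportional to \<open>t\<close>,
  all others have nonzero limits. Negative values of \<open>\<alpha>\<close> are used for conjugates of nodes.\<close>

lemma scaled_node_product_tendsto:
  fixes lam :: "nat \<Rightarrow> real" and \<alpha> :: real
  assumes S: "finite S" "fst ` S \<subseteq> J" and inj: "inj_on lam J" and j: "j \<in> J"
    and \<alpha>: "\<And>b. (j, b) \<in> S \<Longrightarrow> \<alpha> \<noteq> real b"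
  obtains L where "((\<lambda>t. complex_of_real t ^ card {s \<in> S. fst s = j} /
      (\<Prod>s\<in>S. complex_of_real (lam j) + \<i> * complex_of_real (\<alpha> * t) - cluster_node lam t s)) \<longlongrightarrow> L) (at_right 0)"
proof -
  define q where "q s t = (if fst s = j then complex_of_real t else 1) /
    (complex_of_real (lam j) + \<i> * complex_of_real (\<alpha> * t) - cluster_node lam t s)" for s t
  have "\<exists>l. (q s \<longlongrightarrow> l) (at_right 0)" if s: "s \<in> S" for s
  proof (cases "fst s = j")
    case True
    define d where "d = \<i> * complex_of_real (\<alpha> - real (snd s))"
    have d: "d \<noteq> 0"
      using \<alpha>[of "snd s"] s True by (auto simp: d_def simp del: of_real_diff)
    have "\<forall>\<^sub>F t in at_right 0. 1 / d = q s t"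
      using eventually_at_right_less[of 0]
    proof eventually_elim
      case (elim t)
      have "complex_of_real (lam j) + \<i> * complex_of_real (\<alpha> * t) - cluster_node lam t s = complex_of_real t * d"
        using True by (simp add: cluster_node_def d_def algebra_simps)
      then show ?case
        using elim True d by (simp add: q_def)
    qed
    then have "(q s \<longlongrightarrow> 1 / d) (at_right 0)"
      by (rule Lim_transform_eventually[OF tendsto_const])
    then show ?thesis ..
  next
    case False
    then have "lam j \<noteq> lam (fst s)"
      using inj_onD[OF inj, of j "fst s"] S(2) s j by auto
    then have "complex_of_real (lam j) - complex_of_real (lam (fst s)) \<noteq> 0"
      by simp
    moreover have "((\<lambda>t. complex_of_real (lam j) + \<i> * complex_of_real (\<alpha> * t) - cluster_node lam t s)
        \<longlongrightarrow> complex_of_real (lam j) - complex_of_real (lam (fst s))) (at_right 0)"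
      by (auto intro!: tendsto_eq_intros cluster_node_tendsto)
    ultimately have "((\<lambda>t. 1 / (complex_of_real (lam j) + \<i> * complex_of_real (\<alpha> * t) - cluster_node lam t s))
        \<longlongrightarrow> 1 / (complex_of_real (lam j) - complex_of_real (lam (fst s)))) (at_right 0)"
      by (intro tendsto_divide tendsto_const)
    then show ?thesis
      using False unfolding q_def by auto
  qed
  then obtain l where "\<And>s. s \<in> S \<Longrightarrow> (q s \<longlongrightarrow> l s) (at_right 0)"
    by metis
  then have "((\<lambda>t. \<Prod>s\<in>S. q s t) \<longlongrightarrow> (\<Prod>s\<in>S. l s)) (at_right 0)"
    by (rule tendsto_prod)
  moreover have "(\<Prod>s\<in>S. q s t) = complex_of_real t ^ card {s \<in> S. fst s = j} /
      (\<Prod>s\<in>S. complex_of_real (lam j) + \<i> * complex_of_real (\<alpha> * t) - cluster_node lam t s)" for t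
  proof -
    have "(\<Prod>s\<in>S. if fst s = j then complex_of_real t else 1) = complex_of_real t ^ card {s \<in> S. fst s = j}"
      using S(1) by (simp add: prod.If_cases Int_def)
    then show ?thesis
      by (simp add: q_def prod_dividef)
  qed
  ultimately show ?thesis
    by (intro that) simp
qed

text \<open>Residues at a node are \<open>O(t powr (1 - p j))\<close>, since the node has \<open>p j - 1\<close> close neighbours.\<close>

lemma cluster_residue_tendsto:
  fixes J :: "nat set" and lam :: "nat \<Rightarrow> real" and p :: "nat \<Rightarrow> nat"
  defines "T \<equiv> Sigma J (\<lambda>j. {1..p j})"
  assumes J: "finite J" "inj_on lam J" and s: "s \<in> T"
  obtains L where "((\<lambda>t. complex_of_real t ^ (p (fst s) - 1) * (poly q (cluster_node lam t s) /
      (\<Prod>s'\<in>T - {s}. cluster_node lam t s - cluster_node lam t s'))) \<longlongrightarrow> L) (at_right 0)"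
proof -
  obtain j a where ja: "s = (j, a)" "j \<in> J" "a \<in> {1..p j}"
    using s by (auto simp: T_def)
  have "finite T"
    using J by (simp add: T_def)
  have "{s' \<in> T - {s}. fst s' = j} = Pair j ` ({1..p j} - {a})"
    using ja by (auto simp: T_def)
  then have card: "card {s' \<in> T - {s}. fst s' = j} = p j - 1"
    using ja by (simp add: card_image inj_on_def)
  obtain L where L: "((\<lambda>t. complex_of_real t ^ card {s' \<in> T - {s}. fst s' = j} /
      (\<Prod>s'\<in>T - {s}. complex_of_real (lam j) + \<i> * complex_of_real (real a * t) - cluster_node lam t s')) \<longlongrightarrow> L) (at_right 0)"
  proof (rule scaled_node_product_tendsto[of "T - {s}" J lam j "real a"])
    show "real a \<noteq> real b" if "(j, b) \<in> T - {s}" for b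
      using that ja(1) by auto
  qed (use \<open>finite T\<close> J ja in \<open>auto simp: T_def\<close>)
  have "((\<lambda>t. poly q (cluster_node lam t s)) \<longlongrightarrow> poly q (complex_of_real (lam (fst s)))) (at_right 0)"
    by (intro tendsto_poly cluster_node_tendsto)
  moreover have "((\<lambda>t. complex_of_real t ^ (p (fst s) - 1) /
      (\<Prod>s'\<in>T - {s}. cluster_node lam t s - cluster_node lam t s')) \<longlongrightarrow> L) (at_right 0)"
    using L unfolding card by (simp only: cluster_node_def ja(1) fst_conv snd_conv)
  ultimately have "((\<lambda>t. poly q (cluster_node lam t s) * (complex_of_real t ^ (p (fst s) - 1) /
      (\<Prod>s'\<in>T - {s}. cluster_node lam t s - cluster_node lam t s')))
      \<longlongrightarrow> poly q (complex_of_real (lam (fst s))) * L) (at_right 0)"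
    by (rule tendsto_mult)
  then show ?thesis
    by (intro that) (simp add: mult.commute)
qed

text \<open>Values at the conjugate of a node are \<open>O(t powr (- p j))\<close>, since all \<open>p j\<close> nodes of the
  cluster are close to it.\<close>

lemma cluster_value_tendsto:
  fixes J :: "nat set" and lam :: "nat \<Rightarrow> real" and p :: "nat \<Rightarrow> nat"
  defines "T \<equiv> Sigma J (\<lambda>j. {1..p j})"
  assumes J: "finite J" "inj_on lam J" and s: "s \<in> T"
  obtains L where "((\<lambda>t. complex_of_real t ^ p (fst s) * (poly q (cnj (cluster_node lam t s)) /
      (\<Prod>s'\<in>T. cnj (cluster_node lam t s) - cluster_node lam t s'))) \<longlongrightarrow> L) (at_right 0)"
proof -
  obtain j a where ja: "s = (j, a)" "j \<in> J" "a \<in> {1..p j}"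
    using s by (auto simp: T_def)
  have "finite T"
    using J by (simp add: T_def)
  have "{s' \<in> T. fst s' = j} = Pair j ` {1..p j}"
    using ja by (auto simp: T_def)
  then have card: "card {s' \<in> T. fst s' = j} = p j"
    by (simp add: card_image inj_on_def)
  obtain L where L: "((\<lambda>t. complex_of_real t ^ card {s' \<in> T. fst s' = j} /
      (\<Prod>s'\<in>T. complex_of_real (lam j) + \<i> * complex_of_real (- real a * t) - cluster_node lam t s')) \<longlongrightarrow> L) (at_right 0)"
  proof (rule scaled_node_product_tendsto[of T J lam j "- real a"])
    show "- real a \<noteq> real b" if "(j, b) \<in> T" for b
      using ja(3) by auto
  qed (use \<open>finite T\<close> J ja in \<open>auto simp: T_def\<close>)
  have cnj_node: "cnj (cluster_node lam t (j, a)) = complex_of_real (lam j) + \<i> * complex_of_real (- real a * t)" for t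
    by (simp add: cluster_node_def ja(1))
  have "((\<lambda>t. poly q (cnj (cluster_node lam t s))) \<longlongrightarrow> poly q (cnj (complex_of_real (lam (fst s))))) (at_right 0)"
    by (intro tendsto_poly tendsto_cnj cluster_node_tendsto)
  moreover have "((\<lambda>t. complex_of_real t ^ p (fst s) /
      (\<Prod>s'\<in>T. cnj (cluster_node lam t s) - cluster_node lam t s')) \<longlongrightarrow> L) (at_right 0)"
    using L unfolding card by (simp only: cnj_node ja(1) fst_conv)
  ultimately have "((\<lambda>t. poly q (cnj (cluster_node lam t s)) * (complex_of_real t ^ p (fst s) /
      (\<Prod>s'\<in>T. cnj (cluster_node lam t s) - cluster_node lam t s')))
      \<longlongrightarrow> poly q (cnj (complex_of_real (lam (fst s)))) * L) (at_right 0)"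
    by (rule tendsto_mult)
  then show ?thesis
    by (intro that) (simp add: mult.commute)
qed

section \<open>Boundary decay forces negative squares\<close>

lemma cluster_node_inj:
  assumes "inj_on lam J" "t > 0"
  shows "inj_on (cluster_node lam t) (Sigma J B)"
proof (rule inj_onI)
  fix s s' assume s: "s \<in> Sigma J B" "s' \<in> Sigma J B" and eq: "cluster_node lam t s = cluster_node lam t s'"
  have "lam (fst s) = lam (fst s')"
    using arg_cong[OF eq, of Re] by (simp add: cluster_node_def)
  moreover have "snd s = snd s'"
    using arg_cong[OF eq, of Im] assms(2) by (simp add: cluster_node_def)
  ultimately show "s = s'"
    using s inj_onD[OF assms(1), of "fst s" "fst s'"] by (auto intro: prod_eqI)
qed

text \<open>The vector \<open>\<gamma> w\<close> combines the residues of \<open>q w / (\<Prod>z\<in>Z. x - z)\<close> on \<open>Z\<close> with a small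
  multiple of the unit vector at \<open>w\<close>, so its rational function is explicit.\<close>

lemma half_form_poles_and_points:
  fixes Z W :: "complex set" and q :: "complex \<Rightarrow> complex poly" and \<sigma> :: real
  defines "\<gamma> \<equiv> \<lambda>w x. if x \<in> Z then poly (q w) x / (\<Prod>z\<in>Z - {x}. x - z) else if x = w then - of_real \<sigma> else 0"
    and "R \<equiv> \<lambda>v x. poly (q v) x / (\<Prod>z\<in>Z. x - z) + (- of_real \<sigma>) / (x - v)"
  assumes Z: "finite Z" "Z \<subseteq> upper_half_plane" and W: "finite W" "W \<subseteq> upper_half_plane"
    and disjoint: "Z \<inter> W = {}" and deg: "\<And>v. v \<in> W \<Longrightarrow> degree (q v) < card Z"
    and wv: "w \<in> W" "v \<in> W"
  shows "half_form f (Z \<union> W) (\<gamma> w) (\<gamma> v) =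
    (\<Sum>x\<in>Z. poly (q w) x / (\<Prod>z\<in>Z - {x}. x - z) * f x * cnj (R v (cnj x))) +
    (- of_real \<sigma>) * f w * cnj (R v (cnj w))"
proof -
  have \<gamma>_Z: "\<gamma> u x = poly (q u) x / (\<Prod>z\<in>Z - {x}. x - z)" if "x \<in> Z" for u x
    using that by (simp add: \<gamma>_def)
  have \<gamma>_W: "\<gamma> u x = (if x = u then - of_real \<sigma> else 0)" if "x \<in> W" for u x
    using that disjoint by (auto simp: \<gamma>_def)
  have inner: "(\<Sum>y\<in>Z \<union> W. \<gamma> v y / (cnj x - y)) = R v (cnj x)" if x: "x \<in> Z \<union> W" for x
  proof -
    have "Im x > 0"
      using x Z(2) W(2) by (auto simp: upper_half_plane_def)
    then have "cnj x \<notin> upper_half_plane"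
      by (simp add: upper_half_plane_def)
    then have "cnj x \<notin> Z"
      using Z(2) by blast
    then have "(\<Sum>y\<in>Z. \<gamma> v y / (cnj x - y)) = poly (q v) (cnj x) / (\<Prod>z\<in>Z. cnj x - z)"
      using partial_fractions_simple_poles[OF Z(1) deg[OF wv(2)]] by (simp add: \<gamma>_Z)
    moreover have "(\<Sum>y\<in>W. \<gamma> v y / (cnj x - y)) = (\<Sum>y\<in>W. if y = v then - of_real \<sigma> / (cnj x - v) else 0)"
      by (intro sum.cong refl) (simp add: \<gamma>_W)
    ultimately show ?thesis
      using W(1) wv(2) by (simp add: sum.union_disjoint[OF Z(1) W(1) disjoint] R_def)
  qed
  have "half_form f (Z \<union> W) (\<gamma> w) (\<gamma> v) = (\<Sum>x\<in>Z \<union> W. \<gamma> w x * f x * cnj (R v (cnj x)))"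
    unfolding half_form_def by (intro sum.cong refl) (simp only: inner)
  also have "\<dots> = (\<Sum>x\<in>Z. \<gamma> w x * f x * cnj (R v (cnj x))) + (\<Sum>x\<in>W. \<gamma> w x * f x * cnj (R v (cnj x)))"
    by (rule sum.union_disjoint[OF Z(1) W(1) disjoint])
  also have "(\<Sum>x\<in>Z. \<gamma> w x * f x * cnj (R v (cnj x))) =
      (\<Sum>x\<in>Z. poly (q w) x / (\<Prod>z\<in>Z - {x}. x - z) * f x * cnj (R v (cnj x)))"
    by (intro sum.cong refl) (simp only: \<gamma>_Z)
  also have "(\<Sum>x\<in>W. \<gamma> w x * f x * cnj (R v (cnj x))) =
      (\<Sum>x\<in>W. if x = w then (- of_real \<sigma>) * f w * cnj (R v (cnj w)) else 0)"
    by (intro sum.cong refl) (simp add: \<gamma>_W)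
  also have "\<dots> = (- of_real \<sigma>) * f w * cnj (R v (cnj w))"
    using W(1) wv(1) by simp
  finally show ?thesis .
qed

text \<open>The pairing of the two spaces contributes \<open>- \<sigma>\<close> on the diagonal, to first order in \<open>\<sigma>\<close>, whereas
  the vectors on fixed points contribute only to second order; the choice of \<open>\<sigma>\<close> makes the latter
  negligible.\<close>

lemma small_gram_perturbation:
  assumes "finite W" "W \<noteq> {}"
  obtains \<sigma> \<eta> :: real where "\<eta> * card W < \<sigma>"
    and "\<And>w v. w \<in> W \<Longrightarrow> v \<in> W \<Longrightarrow> cmod (of_real \<sigma> * of_real \<sigma> * B w v) < \<eta>"
proof -
  define M where "M = 1 + (\<Sum>w\<in>W. \<Sum>v\<in>W. cmod (B w v))"
  define N where "N = real (card W)"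
  define \<sigma> where "\<sigma> = 1 / (2 * N * M)"
  have N: "N > 0"
    using assms by (simp add: N_def card_gt_0_iff)
  have M: "M > 0"
    unfolding M_def by (intro add_pos_nonneg sum_nonneg) auto
  have B: "cmod (B w v) < M" if "w \<in> W" "v \<in> W" for w v
  proof -
    have "cmod (B w v) \<le> (\<Sum>v\<in>W. cmod (B w v))"
      using assms that by (intro member_le_sum) auto
    also have "\<dots> \<le> (\<Sum>w\<in>W. \<Sum>v\<in>W. cmod (B w v))"
      using assms that by (intro member_le_sum[of w W "\<lambda>w. \<Sum>v\<in>W. cmod (B w v)"] sum_nonneg) auto
    finally show ?thesis
      by (simp add: M_def)
  qed
  have \<sigma>: "\<sigma> > 0"
    using M N by (simp add: \<sigma>_def)
  show ?thesis
  proof (rule that[of "\<sigma> / (2 * N)" \<sigma>])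
    show "\<sigma> / (2 * N) * card W < \<sigma>"
      using \<sigma> N by (simp add: N_def)
    fix w v assume "w \<in> W" "v \<in> W"
    have "cmod (of_real \<sigma> * of_real \<sigma> * B w v) = \<sigma> * \<sigma> * cmod (B w v)"
      using \<sigma> by (simp add: norm_mult)
    also have "\<dots> < \<sigma> * \<sigma> * M"
      using B[OF \<open>w \<in> W\<close> \<open>v \<in> W\<close>] \<sigma> by (intro mult_strict_left_mono) auto
    also have "\<dots> = \<sigma> / (2 * N)"
      using M N by (simp add: \<sigma>_def)
    finally show "cmod (of_real \<sigma> * of_real \<sigma> * B w v) < \<sigma> / (2 * N)" .
  qed
qed

text \<open>Otherwise one could pick as many points \<open>w\<close> with \<open>f w \<noteq> 0\<close> as there are nodes. The
  vectors \<open>\<gamma> w\<close> of \<open>half_form_poles_and_points\<close> then have, in the limit, the Gram matrix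
  \<open>- \<sigma>\<close> times the identity up to \<open>O(\<sigma>\<^sup>2)\<close>, which is too many negative squares. The
  nodes have to lie in \<open>\<Omega>\<close> only for some arbitrarily small \<open>t\<close>.\<close>

theorem finite_nonzero_set_if_boundary_decay:
  fixes J :: "nat set" and lam :: "nat \<Rightarrow> real" and p :: "nat \<Rightarrow> nat" and f :: "complex \<Rightarrow> complex"
  defines "T \<equiv> Sigma J (\<lambda>j. {1..p j})"
  assumes K: "nonneg_modulo k \<Omega> (nevanlinna_kernel f)" and \<Omega>: "\<Omega> \<subseteq> upper_half_plane"
    and J: "finite J" "inj_on lam J"
    and accessible: "\<exists>\<^sub>F t in at_right 0. \<forall>s\<in>T. cluster_node lam t s \<in> \<Omega>"
    and decay: "\<And>s. s \<in> T \<Longrightarrow>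
      ((\<lambda>t. f (cluster_node lam t s) / complex_of_real t ^ (2 * p (fst s) - 1)) \<longlongrightarrow> 0) (at_right 0)"
    and many: "k < (\<Sum>j\<in>J. p j)"
  shows "finite {z \<in> \<Omega>. f z \<noteq> 0}"
proof (rule ccontr)
  assume "infinite {z \<in> \<Omega>. f z \<noteq> 0}"
  then obtain W where W: "finite W" "card W = (\<Sum>j\<in>J. p j)" "W \<subseteq> {z \<in> \<Omega>. f z \<noteq> 0}"
    using infinite_arbitrarily_large by blast
  have finite_T: "finite T" and card_T: "card T = card W"
    using J W(2) by (auto simp: T_def)
  have W_upper: "Im w > 0" and W_nonzero: "f w \<noteq> 0" if "w \<in> W" for w
    using that W(3) \<Omega> by (auto simp: upper_half_plane_def)
  define P where "P x = (\<Prod>s\<in>T. x - complex_of_real (lam (fst s)))" for x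
  have P: "P (cnj w) \<noteq> 0" if "w \<in> W" for w
  proof -
    have "cnj w \<noteq> complex_of_real r" for r
      using W_upper[OF that] by (auto simp: complex_eq_iff)
    then show ?thesis
      using finite_T by (simp add: P_def prod_zero_iff)
  qed
  \<comment> \<open>The numerators are dual to the points under the limiting pairing
    \<open>f w * cnj (q x / P x)\<close> at \<open>x = cnj w\<close>.\<close>
  have "\<exists>q. degree q < card W \<and> (\<forall>w\<in>W. poly q (cnj w) = (if w = v then P (cnj v) / cnj (f v) else 0))"
    if "v \<in> W" for v
  proof -
    have "finite (cnj ` W)" "cnj v \<in> cnj ` W"
      using W(1) that by auto
    then obtain q where q: "degree q < card (cnj ` W)"
      "\<And>x. x \<in> cnj ` W \<Longrightarrow> poly q x = (if x = cnj v then P (cnj v) / cnj (f v) else 0)"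
      by (rule interpolation_polynomial[where c = "P (cnj v) / cnj (f v)"]) blast
    have "card (cnj ` W) = card W"
      by (intro card_image inj_onI) simp
    then show ?thesis
      using q by auto
  qed
  then obtain q where deg: "\<And>v. v \<in> W \<Longrightarrow> degree (q v) < card W"
    and q: "\<And>v w. v \<in> W \<Longrightarrow> w \<in> W \<Longrightarrow> poly (q v) (cnj w) = (if w = v then P (cnj v) / cnj (f v) else 0)"
    by metis
  have "W \<noteq> {}"
    using W(2) many by auto
  then obtain \<sigma> \<eta> :: real where small: "\<eta> * card W < \<sigma>"
    and \<eta>: "\<And>w v. w \<in> W \<Longrightarrow> v \<in> W \<Longrightarrow> cmod (of_real \<sigma> * of_real \<sigma> * (f w / (w - cnj v))) < \<eta>"
    using small_gram_perturbation[OF W(1), of "\<lambda>w v. f w / (w - cnj v)"] by metis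
  \<comment> \<open>\<open>\<rho>\<close> is a residue, \<open>R\<close> a value of the rational function of a vector, and \<open>H\<close> the Gram matrix,
    written as a sum over the indices of the nodes so that its limit can be taken term by term.\<close>
  define \<rho> where "\<rho> w t s = poly (q w) (cluster_node lam t s) /
    (\<Prod>s'\<in>T - {s}. cluster_node lam t s - cluster_node lam t s')" for w t s
  define R where "R v t x = poly (q v) x / (\<Prod>s\<in>T. x - cluster_node lam t s) + (- of_real \<sigma>) / (x - v)" for v t x
  define H where "H w v t = (\<Sum>s\<in>T. \<rho> w t s * f (cluster_node lam t s) * cnj (R v t (cnj (cluster_node lam t s)))) +
    (- of_real \<sigma>) * f w * cnj (R v t (cnj w))" for w v t
  have cluster_terms: "((\<lambda>t. \<rho> w t s * f (cluster_node lam t s) * cnj (R v t (cnj (cluster_node lam t s)))) \<longlongrightarrow> 0) (at_right 0)"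
    if s: "s \<in> T" and v: "v \<in> W" for w v s
  proof -
    let ?p = "p (fst s)"
    have p: "?p \<ge> 1"
      using s by (auto simp: T_def)
    obtain L where L: "((\<lambda>t. complex_of_real t ^ (?p - 1) * \<rho> w t s) \<longlongrightarrow> L) (at_right 0)"
      using cluster_residue_tendsto[OF J, of s p "q w"] s unfolding T_def \<rho>_def by blast
    obtain L' where L': "((\<lambda>t. complex_of_real t ^ ?p * (poly (q v) (cnj (cluster_node lam t s)) /
        (\<Prod>s'\<in>T. cnj (cluster_node lam t s) - cluster_node lam t s'))) \<longlongrightarrow> L') (at_right 0)"
      using cluster_value_tendsto[OF J, of s p "q v"] s unfolding T_def by blast
    have "cnj (complex_of_real (lam (fst s))) - v \<noteq> 0"
      using W_upper[OF v] by (auto simp: complex_eq_iff)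
    then have "((\<lambda>t. complex_of_real t ^ ?p * ((- of_real \<sigma>) / (cnj (cluster_node lam t s) - v)))
        \<longlongrightarrow> 0 * ((- of_real \<sigma>) / (cnj (complex_of_real (lam (fst s))) - v))) (at_right 0)"
      using p by (intro tendsto_mult tendsto_divide tendsto_diff tendsto_cnj cluster_node_tendsto tendsto_const)
        (auto intro!: tendsto_eq_intros)
    from tendsto_add[OF L' this]
    have "((\<lambda>t. complex_of_real t ^ ?p * R v t (cnj (cluster_node lam t s))) \<longlongrightarrow> L') (at_right 0)"
      unfolding R_def distrib_left mult_zero_left add_0_right .
    \<comment> \<open>The exponents \<open>p - 1\<close> and \<open>p\<close> add up to \<open>2 * p - 1\<close>, the order of the decay of \<open>f\<close>.\<close>
    from tendsto_mult[OF tendsto_mult[OF L decay[OF s]] tendsto_cnj[OF this]]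
    have "((\<lambda>t. (complex_of_real t ^ (?p - 1) * \<rho> w t s) * (f (cluster_node lam t s) / complex_of_real t ^ (2 * ?p - 1)) *
        cnj (complex_of_real t ^ ?p * R v t (cnj (cluster_node lam t s)))) \<longlongrightarrow> 0) (at_right 0)"
      by simp
    moreover have "\<forall>\<^sub>F t in at_right 0. (complex_of_real t ^ (?p - 1) * \<rho> w t s) * (f (cluster_node lam t s) / complex_of_real t ^ (2 * ?p - 1)) *
        cnj (complex_of_real t ^ ?p * R v t (cnj (cluster_node lam t s))) =
        \<rho> w t s * f (cluster_node lam t s) * cnj (R v t (cnj (cluster_node lam t s)))"
      using eventually_at_right_less[of 0]
    proof eventually_elim
      case (elim t)
      have "complex_of_real t ^ (2 * ?p - 1) = complex_of_real t ^ (?p - 1) * complex_of_real t ^ ?p"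
        using p by (simp add: mult_2 flip: power_add)
      then show ?case
        using elim by simp
    qed
    ultimately show ?thesis
      by (rule Lim_transform_eventually)
  qed
  have point_term: "((\<lambda>t. (- of_real \<sigma>) * f w * cnj (R v t (cnj w))) \<longlongrightarrow>
      - (if w = v then of_real \<sigma> else 0) + of_real \<sigma> * of_real \<sigma> * (f w / (w - cnj v))) (at_right 0)"
    if w: "w \<in> W" and v: "v \<in> W" for w v
  proof -
    have "((\<lambda>t. \<Prod>s\<in>T. cnj w - cluster_node lam t s) \<longlongrightarrow> P (cnj w)) (at_right 0)"
      unfolding P_def by (intro tendsto_prod tendsto_diff tendsto_const cluster_node_tendsto)
    then have "((\<lambda>t. (- of_real \<sigma>) * f w * cnj (R v t (cnj w))) \<longlongrightarrow>
        (- of_real \<sigma>) * f w * cnj (poly (q v) (cnj w) / P (cnj w) + (- of_real \<sigma>) / (cnj w - v))) (at_right 0)"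
      unfolding R_def by (intro tendsto_intros P[OF w])
    also have "(- of_real \<sigma>) * f w * cnj (poly (q v) (cnj w) / P (cnj w) + (- of_real \<sigma>) / (cnj w - v)) =
        - (if w = v then of_real \<sigma> else 0) + of_real \<sigma> * of_real \<sigma> * (f w / (w - cnj v))"
      using W_nonzero[OF w] P[OF w] by (cases "w = v") (auto simp: q v w algebra_simps)
    finally show ?thesis .
  qed
  have "\<forall>\<^sub>F t in at_right 0. cmod (H w v t + (if w = v then of_real \<sigma> else 0)) < \<eta>"
    if "w \<in> W" "v \<in> W" for w v
  proof -
    have "((\<lambda>t. H w v t) \<longlongrightarrow> (\<Sum>s\<in>T. 0) +
        (- (if w = v then of_real \<sigma> else 0) + of_real \<sigma> * of_real \<sigma> * (f w / (w - cnj v)))) (at_right 0)"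
      unfolding H_def by (intro tendsto_add tendsto_sum cluster_terms point_term that)
    then have "((\<lambda>t. cmod (H w v t + (if w = v then of_real \<sigma> else 0))) \<longlongrightarrow>
        cmod ((\<Sum>s\<in>T. 0) + (- (if w = v then of_real \<sigma> else 0) + of_real \<sigma> * of_real \<sigma> * (f w / (w - cnj v))) +
          (if w = v then of_real \<sigma> else 0))) (at_right 0)"
      by (intro tendsto_norm tendsto_add tendsto_const)
    moreover have "cmod ((\<Sum>s\<in>T. 0) + (- (if w = v then of_real \<sigma> else 0) + of_real \<sigma> * of_real \<sigma> * (f w / (w - cnj v))) +
          (if w = v then of_real \<sigma> else 0)) < \<eta>"
      using \<eta>[OF that] by simp
    ultimately show ?thesis
      by (rule order_tendstoD(2))
  qed
  then have gram: "\<forall>\<^sub>F t in at_right 0. \<forall>w\<in>W. \<forall>v\<in>W. cmod (H w v t + (if w = v then of_real \<sigma> else 0)) < \<eta>"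
    using W(1) by (intro eventually_ball_finite ballI) auto
  have "\<forall>\<^sub>F t in at_right 0. cluster_node lam t s \<noteq> w" if "s \<in> T" "w \<in> W" for s w
    by (rule tendsto_imp_eventually_ne[OF cluster_node_tendsto]) (use W_upper[OF that(2)] in auto)
  then have "\<forall>\<^sub>F t in at_right 0. \<forall>s\<in>T. \<forall>w\<in>W. cluster_node lam t s \<noteq> w"
    using W(1) finite_T by (intro eventually_ball_finite ballI) auto
  with gram have "\<forall>\<^sub>F t in at_right 0. t > 0 \<and> (\<forall>s\<in>T. \<forall>w\<in>W. cluster_node lam t s \<noteq> w) \<and>
      (\<forall>w\<in>W. \<forall>v\<in>W. cmod (H w v t + (if w = v then of_real \<sigma> else 0)) < \<eta>)"
    by (intro eventually_conj eventually_at_right_less)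
  from frequently_ex[OF frequently_eventually_frequently[OF accessible this]] obtain t where t: "t > 0" "\<forall>s\<in>T. cluster_node lam t s \<in> \<Omega>"
      "\<forall>s\<in>T. \<forall>w\<in>W. cluster_node lam t s \<noteq> w"
      "\<forall>w\<in>W. \<forall>v\<in>W. cmod (H w v t + (if w = v then of_real \<sigma> else 0)) < \<eta>"
    by blast
  define Z where "Z = cluster_node lam t ` T"
  have inj: "inj_on (cluster_node lam t) T"
    unfolding T_def by (rule cluster_node_inj[OF J(2) t(1)])
  have Z: "finite Z" "Z \<subseteq> \<Omega>" "Z \<inter> W = {}" "card Z = card W"
    using finite_T t inj card_T by (auto simp: Z_def card_image)
  define \<gamma> where "\<gamma> w x = (if x \<in> Z then poly (q w) x / (\<Prod>z\<in>Z - {x}. x - z) else if x = w then - of_real \<sigma> else 0)" for w x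
  have half_form: "half_form f (Z \<union> W) (\<gamma> w) (\<gamma> v) = H w v t" if "w \<in> W" "v \<in> W" for w v
  proof -
    have R: "poly (q v) x / (\<Prod>z\<in>Z. x - z) + (- of_real \<sigma>) / (x - v) = R v t x" for x
      by (simp add: Z_def R_def prod.reindex[OF inj])
    have \<rho>: "poly (q w) (cluster_node lam t s) / (\<Prod>z\<in>Z - {cluster_node lam t s}. cluster_node lam t s - z) = \<rho> w t s"
      if "s \<in> T" for s
    proof -
      have "Z - {cluster_node lam t s} = cluster_node lam t ` (T - {s})"
        using that inj by (auto simp: Z_def inj_on_def)
      moreover have "inj_on (cluster_node lam t) (T - {s})"
        using inj by (rule inj_on_subset) auto
      ultimately show ?thesis
        by (simp add: \<rho>_def prod.reindex)
    qed
    have "half_form f (Z \<union> W) (\<gamma> w) (\<gamma> v) =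
        (\<Sum>x\<in>Z. poly (q w) x / (\<Prod>z\<in>Z - {x}. x - z) * f x * cnj (R v t (cnj x))) +
        (- of_real \<sigma>) * f w * cnj (R v t (cnj w))"
      unfolding \<gamma>_def R[symmetric]
      by (rule half_form_poles_and_points) (use Z W \<Omega> deg that in auto)
    also have "(\<Sum>x\<in>Z. poly (q w) x / (\<Prod>z\<in>Z - {x}. x - z) * f x * cnj (R v t (cnj x))) =
        (\<Sum>s\<in>T. \<rho> w t s * f (cluster_node lam t s) * cnj (R v t (cnj (cluster_node lam t s))))"
      unfolding Z_def sum.reindex[OF inj] o_def unfolding Z_def[symmetric]
      by (intro sum.cong refl) (simp only: \<rho>)
    finally show ?thesis
      by (simp only: H_def)
  qed
  show False
  proof (rule not_nonneg_modulo_if_negative_gram_matrix[OF K, of "Z \<union> W" W \<eta> \<sigma> \<gamma>])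
    show "cmod (half_form f (Z \<union> W) (\<gamma> w) (\<gamma> v) + (if w = v then of_real \<sigma> else 0)) \<le> \<eta>"
      if "w \<in> W" "v \<in> W" for w v
      unfolding half_form[OF that] using t(4) that by (meson less_imp_le)
  qed (use Z W many small in auto)
qed

section \<open>Asymptotics along the inverted vertical rays\<close>

lemma vertex_notin_angle: "\<epsilon> \<ge> 0 \<Longrightarrow> c \<notin> angle_at c \<epsilon>"
  by (simp add: angle_at_def Arg_zero)

text \<open>\<open>Arg\<close> is insensitive to the positive factor \<open>r\<close> and continuous on the positive imaginary axis,
  where it is \<open>pi / 2\<close>.\<close>

lemma eventually_in_angle:
  assumes \<zeta>: "((\<lambda>t. \<zeta> t * complex_of_real (r t)) \<longlongrightarrow> \<i> * complex_of_real c) F" and "c > 0"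
    and r: "\<forall>\<^sub>F t in F. r t > 0"
  shows "\<forall>\<^sub>F t in F. \<zeta> t \<in> angle_at 0 (pi / 4)"
proof -
  have "\<i> * complex_of_real c \<notin> \<real>\<^sub>\<le>\<^sub>0"
    using \<open>c > 0\<close> by (auto simp: complex_nonpos_Reals_iff)
  then have "((\<lambda>t. Arg (\<zeta> t * complex_of_real (r t))) \<longlongrightarrow> Arg (\<i> * complex_of_real c)) F"
    by (intro isCont_tendsto_compose[OF continuous_at_Arg \<zeta>])
  then have lim: "((\<lambda>t. Arg (\<zeta> t * complex_of_real (r t))) \<longlongrightarrow> pi / 2) F"
    using \<open>c > 0\<close> by (simp add: Arg_times_of_real2)
  have "\<forall>\<^sub>F t in F. pi / 4 < Arg (\<zeta> t * complex_of_real (r t))"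
    by (rule order_tendstoD(1)[OF lim]) simp
  moreover have "\<forall>\<^sub>F t in F. Arg (\<zeta> t * complex_of_real (r t)) < pi - pi / 4"
    by (rule order_tendstoD(2)[OF lim]) simp
  ultimately show ?thesis
    using r by eventually_elim (simp add: angle_at_def Arg_times_of_real2)
qed

lemma decay_along_path:
  fixes F G :: "complex \<Rightarrow> complex" and \<gamma> :: "real \<Rightarrow> complex"
  assumes "((\<lambda>t. F (\<gamma> t) / G (\<gamma> t)) \<longlongrightarrow> 0) (at_right 0)"
    and "((\<lambda>t. G (\<gamma> t) / complex_of_real t ^ m) \<longlongrightarrow> L) (at_right 0)"
    and "\<forall>\<^sub>F t in at_right 0. G (\<gamma> t) \<noteq> 0" and "M \<le> m"
  shows "((\<lambda>t. F (\<gamma> t) / complex_of_real t ^ M) \<longlongrightarrow> 0) (at_right 0)"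
proof -
  have "((\<lambda>t. complex_of_real t ^ (m - M)) \<longlongrightarrow> complex_of_real 0 ^ (m - M)) (at_right 0)"
    by (intro tendsto_power tendsto_of_real tendsto_ident_at)
  from tendsto_mult[OF tendsto_mult[OF assms(1,2)] this]
  have "((\<lambda>t. F (\<gamma> t) / G (\<gamma> t) * (G (\<gamma> t) / complex_of_real t ^ m) * complex_of_real t ^ (m - M)) \<longlongrightarrow> 0) (at_right 0)"
    by simp
  moreover have "\<forall>\<^sub>F t in at_right 0. F (\<gamma> t) / G (\<gamma> t) * (G (\<gamma> t) / complex_of_real t ^ m) * complex_of_real t ^ (m - M) =
      F (\<gamma> t) / complex_of_real t ^ M"
    using assms(3) eventually_at_right_less[of 0]
  proof eventually_elim
    case (elim t)
    have "complex_of_real t ^ m = complex_of_real t ^ M * complex_of_real t ^ (m - M)"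
      using \<open>M \<le> m\<close> by (simp flip: power_add)
    then show ?case
      using elim by simp
  qed
  ultimately show ?thesis
    by (rule Lim_transform_eventually)
qed

text \<open>The path is \<open>\<mu> + \<i> / (a * t)\<close>: it goes to infinity asymptotically in the vertical
  direction, with modulus comparable to \<open>1 / t\<close>.\<close>

lemma inverted_ray_decay_infinity:
  fixes F :: "complex \<Rightarrow> complex" and \<mu> a :: real
  assumes F: "F \<in> o[angle_filter_infinity (pi / 4)](\<lambda>\<zeta>. complex_of_real (1 / cmod \<zeta> ^ m))"
    and "a > 0" "M \<le> m"
  shows "((\<lambda>t. F (complex_of_real \<mu> - 1 / (\<i> * complex_of_real (a * t))) / complex_of_real t ^ M) \<longlongrightarrow> 0) (at_right 0)"
proof -
  define \<gamma> where "\<gamma> t = complex_of_real \<mu> - 1 / (\<i> * complex_of_real (a * t))" for t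
  have "((\<lambda>t. complex_of_real (\<mu> * t) + \<i> * complex_of_real (1 / a)) \<longlongrightarrow> complex_of_real (\<mu> * 0) + \<i> * complex_of_real (1 / a)) (at_right 0)"
    by (intro tendsto_intros)
  moreover have "\<forall>\<^sub>F t in at_right 0. complex_of_real (\<mu> * t) + \<i> * complex_of_real (1 / a) = \<gamma> t * complex_of_real t"
    using eventually_at_right_less[of 0]
  proof eventually_elim
    case (elim t)
    then show ?case
      using \<open>a > 0\<close> by (simp add: \<gamma>_def left_diff_distrib divide_simps) (simp add: algebra_simps)
  qed
  ultimately have scaled: "((\<lambda>t. \<gamma> t * complex_of_real t) \<longlongrightarrow> \<i> * complex_of_real (1 / a)) (at_right 0)"
    by (simp add: Lim_transform_eventually)
  have scaled_at_top: "filterlim (\<lambda>t. cmod (\<gamma> t * complex_of_real t) * inverse t) at_top (at_right 0)"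
    using \<open>a > 0\<close>
    by (intro filterlim_tendsto_pos_mult_at_top[OF tendsto_norm[OF scaled] _ filterlim_inverse_at_top_right]) simp
  have cancel: "\<forall>\<^sub>F t in at_right 0. cmod (\<gamma> t * complex_of_real t) * inverse t = cmod (\<gamma> t)"
    using eventually_at_right_less[of 0] by eventually_elim (simp add: norm_mult)
  have "filterlim (\<lambda>t. cmod (\<gamma> t)) at_top (at_right 0)"
    by (rule iffD1[OF filterlim_cong[OF refl refl cancel] scaled_at_top])
  then have at_infinity: "filterlim \<gamma> at_infinity (at_right 0)"
    by (rule filterlim_norm_at_top_imp_at_infinity)
  have angle: "\<forall>\<^sub>F t in at_right 0. \<gamma> t \<in> angle_at 0 (pi / 4)"
    by (rule eventually_in_angle[OF scaled]) (use \<open>a > 0\<close> eventually_at_right_less in auto)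
  from at_infinity angle have "filterlim \<gamma> (angle_filter_infinity (pi / 4)) (at_right 0)"
    by (simp add: angle_filter_infinity_def filterlim_inf filterlim_principal)
  from smalloD_tendsto[OF landau_o.small.compose[OF F this]]
  have ratio: "((\<lambda>t. F (\<gamma> t) / complex_of_real (1 / cmod (\<gamma> t) ^ m)) \<longlongrightarrow> 0) (at_right 0)" .
  have nz: "\<forall>\<^sub>F t in at_right 0. complex_of_real (1 / cmod (\<gamma> t) ^ m) \<noteq> 0"
    using angle
  proof eventually_elim
    case (elim t)
    then have "\<gamma> t \<noteq> 0"
      using vertex_notin_angle[of "pi / 4" 0] by auto
    then show ?case
      by simp
  qed
  have "((\<lambda>t. complex_of_real (1 / cmod (\<gamma> t * complex_of_real t) ^ m)) \<longlongrightarrow>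
      complex_of_real (1 / cmod (\<i> * complex_of_real (1 / a)) ^ m)) (at_right 0)"
    using \<open>a > 0\<close> by (intro tendsto_intros scaled) auto
  moreover have "\<forall>\<^sub>F t in at_right 0. complex_of_real (1 / cmod (\<gamma> t * complex_of_real t) ^ m) =
      complex_of_real (1 / cmod (\<gamma> t) ^ m) / complex_of_real t ^ m"
    using eventually_at_right_less[of 0]
    by eventually_elim (simp add: norm_mult power_mult_distrib)
  ultimately have "((\<lambda>t. complex_of_real (1 / cmod (\<gamma> t) ^ m) / complex_of_real t ^ m) \<longlongrightarrow>
      complex_of_real (1 / cmod (\<i> * complex_of_real (1 / a)) ^ m)) (at_right 0)"
    by (rule Lim_transform_eventually)
  from decay_along_path[where G = "\<lambda>\<zeta>. complex_of_real (1 / cmod \<zeta> ^ m)", OF ratio this nz \<open>M \<le> m\<close>]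
  show ?thesis
    by (simp only: \<gamma>_def)
qed

text \<open>With \<open>d = \<mu> - x\<close>, the displacement of the path from \<open>x\<close> is
  \<open>\<i> * a * t * d\<^sup>2 / (1 + \<i> * a * t * d)\<close>: the vertical ray above \<open>1 / d\<close> is mapped to a circular
  arc which is vertical at \<open>x\<close>.\<close>

lemma inverted_ray_decay_real:
  fixes F :: "complex \<Rightarrow> complex" and \<mu> x a :: real
  assumes F: "F \<in> o[angle_filter_at x (pi / 4)](\<lambda>\<zeta>. (\<zeta> - complex_of_real x) ^ m)"
    and "a > 0" "M \<le> m" and "\<mu> \<noteq> x"
  shows "((\<lambda>t. F (complex_of_real \<mu> - 1 / (complex_of_real (1 / (\<mu> - x)) + \<i> * complex_of_real (a * t))) /
    complex_of_real t ^ M) \<longlongrightarrow> 0) (at_right 0)"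
proof -
  define d where "d = complex_of_real (\<mu> - x)"
  define \<gamma> where "\<gamma> t = complex_of_real \<mu> - 1 / (complex_of_real (1 / (\<mu> - x)) + \<i> * complex_of_real (a * t))" for t
  have "d \<noteq> 0"
    using \<open>\<mu> \<noteq> x\<close> by (simp add: d_def del: of_real_diff)
  have "((\<lambda>t. \<i> * complex_of_real a * d\<^sup>2 / (1 + \<i> * complex_of_real (a * t) * d)) \<longlongrightarrow>
      \<i> * complex_of_real a * d\<^sup>2 / (1 + \<i> * complex_of_real (a * 0) * d)) (at_right 0)"
    by (intro tendsto_intros) simp
  moreover have "\<forall>\<^sub>F t in at_right 0. \<i> * complex_of_real a * d\<^sup>2 / (1 + \<i> * complex_of_real (a * t) * d) =
      (\<gamma> t - complex_of_real x) * complex_of_real (1 / t)"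
    using eventually_at_right_less[of 0]
  proof eventually_elim
    case (elim t)
    have "Im ((1 + \<i> * complex_of_real (a * t) * d) / d) = a * t"
      using \<open>d \<noteq> 0\<close> by (simp add: add_divide_distrib) (simp add: d_def flip: of_real_diff)
    then have nz: "1 + \<i> * complex_of_real (a * t) * d \<noteq> 0"
      using elim \<open>a > 0\<close> by auto
    have "complex_of_real (1 / (\<mu> - x)) + \<i> * complex_of_real (a * t) = (1 + \<i> * complex_of_real (a * t) * d) / d"
      using \<open>d \<noteq> 0\<close> by (simp add: add_divide_distrib) (simp add: d_def)
    then have "\<gamma> t - complex_of_real x = d - d / (1 + \<i> * complex_of_real (a * t) * d)"
      by (simp add: \<gamma>_def d_def)
    also have "\<dots> = \<i> * complex_of_real (a * t) * d\<^sup>2 / (1 + \<i> * complex_of_real (a * t) * d)"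
      using nz by (simp add: field_simps power2_eq_square)
    finally show ?case
      using elim by simp
  qed
  ultimately have "((\<lambda>t. (\<gamma> t - complex_of_real x) * complex_of_real (1 / t)) \<longlongrightarrow> \<i> * complex_of_real a * d\<^sup>2) (at_right 0)"
    by (simp add: Lim_transform_eventually)
  also have "\<i> * complex_of_real a * d\<^sup>2 = \<i> * complex_of_real (a * (\<mu> - x)\<^sup>2)"
    by (simp add: d_def)
  finally have scaled: "((\<lambda>t. (\<gamma> t - complex_of_real x) * complex_of_real (1 / t)) \<longlongrightarrow> \<i> * complex_of_real (a * (\<mu> - x)\<^sup>2)) (at_right 0)" .
  have "((\<lambda>t. (\<gamma> t - complex_of_real x) * complex_of_real (1 / t) * complex_of_real t) \<longlongrightarrow>
      \<i> * complex_of_real (a * (\<mu> - x)\<^sup>2) * complex_of_real 0) (at_right 0)"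
    by (intro tendsto_mult scaled tendsto_of_real tendsto_ident_at)
  moreover have "\<forall>\<^sub>F t in at_right 0. (\<gamma> t - complex_of_real x) * complex_of_real (1 / t) * complex_of_real t =
      \<gamma> t - complex_of_real x"
    using eventually_at_right_less[of 0] by eventually_elim simp
  ultimately have "((\<lambda>t. \<gamma> t - complex_of_real x) \<longlongrightarrow>
      \<i> * complex_of_real (a * (\<mu> - x)\<^sup>2) * complex_of_real 0) (at_right 0)"
    by (rule Lim_transform_eventually)
  then have lim: "(\<gamma> \<longlongrightarrow> complex_of_real x) (at_right 0)"
    by (simp add: LIM_zero_iff)
  have pos: "a * (\<mu> - x)\<^sup>2 > 0"
    using \<open>a > 0\<close> \<open>\<mu> \<noteq> x\<close> by simp
  have "\<forall>\<^sub>F t in at_right 0. \<gamma> t - complex_of_real x \<in> angle_at 0 (pi / 4)"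
    by (rule eventually_in_angle[OF scaled pos]) (auto intro: eventually_mono[OF eventually_at_right_less])
  then have angle: "\<forall>\<^sub>F t in at_right 0. \<gamma> t \<in> angle_at (complex_of_real x) (pi / 4) \<and> \<gamma> t \<noteq> complex_of_real x"
  proof eventually_elim
    case (elim t)
    then show ?case
      using vertex_notin_angle[of "pi / 4" 0] by (auto simp: angle_at_def)
  qed
  then have "filterlim \<gamma> (angle_filter_at x (pi / 4)) (at_right 0)"
    unfolding angle_filter_at_def filterlim_at using lim by simp
  from smalloD_tendsto[OF landau_o.small.compose[OF F this]]
  have ratio: "((\<lambda>t. F (\<gamma> t) / (\<gamma> t - complex_of_real x) ^ m) \<longlongrightarrow> 0) (at_right 0)" .
  have nz: "\<forall>\<^sub>F t in at_right 0. (\<gamma> t - complex_of_real x) ^ m \<noteq> 0"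
    using angle by eventually_elim simp
  have "((\<lambda>t. ((\<gamma> t - complex_of_real x) * complex_of_real (1 / t)) ^ m) \<longlongrightarrow> (\<i> * complex_of_real (a * (\<mu> - x)\<^sup>2)) ^ m) (at_right 0)"
    by (intro tendsto_power scaled)
  then have "((\<lambda>t. (\<gamma> t - complex_of_real x) ^ m / complex_of_real t ^ m) \<longlongrightarrow> (\<i> * complex_of_real (a * (\<mu> - x)\<^sup>2)) ^ m) (at_right 0)"
    by (simp add: power_divide)
  from decay_along_path[where G = "\<lambda>\<zeta>. (\<zeta> - complex_of_real x) ^ m", OF ratio this nz \<open>M \<le> m\<close>]
  show ?thesis
    by (simp only: \<gamma>_def)
qed


section \<open>Exceptional points\<close>

text \<open>Each point of \<open>C\<close> is met by each path for at most one \<open>t\<close>, and intervals are uncountable.\<close>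

lemma frequently_at_right_avoids_countable:
  assumes "countable C" "finite S" "\<And>s. s \<in> S \<Longrightarrow> inj_on (\<gamma> s) {0<..}"
  shows "\<exists>\<^sub>F t in at_right (0 :: real). \<forall>s\<in>S. \<gamma> s t \<notin> C"
proof (rule ccontr)
  assume "\<not> ?thesis"
  then have "\<forall>\<^sub>F t in at_right 0. \<exists>s\<in>S. \<gamma> s t \<in> C"
    by (simp add: not_frequently)
  then obtain b where b: "b > 0" "\<And>t. 0 < t \<Longrightarrow> t < b \<Longrightarrow> \<exists>s\<in>S. \<gamma> s t \<in> C"
    unfolding eventually_at_right_field by auto
  have "countable (\<Union>s\<in>S. {t \<in> {0<..}. \<gamma> s t \<in> C})"
  proof (rule countable_UN)
    show "countable S"
      using assms(2) by (rule countable_finite)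
    show "countable {t \<in> {0<..}. \<gamma> s t \<in> C}" if "s \<in> S" for s
      by (rule countable_image_inj_gen[OF assms(3)[OF that] assms(1)])
  qed
  moreover have "{0<..<b} \<subseteq> (\<Union>s\<in>S. {t \<in> {0<..}. \<gamma> s t \<in> C})"
  proof
    fix t assume "t \<in> {0<..<b}"
    then show "t \<in> (\<Union>s\<in>S. {t \<in> {0<..}. \<gamma> s t \<in> C})"
      using b(2)[of t] by auto
  qed
  ultimately have "countable {0<..<b}"
    by (rule countable_subset[rotated])
  then show False
    using b(1) uncountable_open_interval[of 0 b] by blast
qed

text \<open>Near \<open>z\<close> the functions have the same limit or a common pole, and this determines the value of
  normalised functions at \<open>z\<close>.\<close>

lemma nicely_meromorphic_eq_if_eventually_eq:
  assumes h: "h nicely_meromorphic_on {z}"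
    and g: "isCont g z \<or> is_pole g z \<and> g z = 0"
    and eq: "\<forall>\<^sub>F w in at z. h w = g w"
  shows "h z = g z"
proof -
  have cont_limit: "f z = l" if "(f \<longlongrightarrow> f z) (at z)" "(f \<longlongrightarrow> l) (at z)" for f :: "complex \<Rightarrow> complex" and l
    using tendsto_unique[OF _ that] by simp
  have pole_not_limit: "\<not> (f \<longlongrightarrow> l) (at z)" if "is_pole f z" for f :: "complex \<Rightarrow> complex" and l
    using not_tendsto_and_filterlim_at_infinity[of "at z" f l] that unfolding is_pole_def by auto
  have pole: "is_pole h z \<longleftrightarrow> is_pole g z"
    by (rule is_pole_cong[OF eq refl])
  have lim: "(h \<longlongrightarrow> l) (at z) \<longleftrightarrow> (g \<longlongrightarrow> l) (at z)" for l
    by (rule tendsto_cong[OF eq])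
  have "is_pole h z \<and> h z = 0 \<or> (h \<longlongrightarrow> h z) (at z)"
    using h by (simp add: nicely_meromorphic_on_def)
  then show ?thesis
    using g pole lim cont_limit pole_not_limit unfolding isCont_def by metis
qed

lemma convex_upper_half_plane: "convex upper_half_plane"
  and open_upper_half_plane: "open upper_half_plane"
  unfolding upper_half_plane_def by (simp_all add: convex_halfspace_Im_gt open_halfspace_Im_gt)

lemma blaschke_product_holomorphic:
  assumes "b \<in> blaschke_products k"
  shows "b holomorphic_on upper_half_plane"
proof -
  obtain a where a: "\<forall>j\<in>{1..k}. a j \<in> upper_half_plane"
    and b: "\<forall>z\<in>upper_half_plane. b z = (\<Prod>j=1..k. (z - a j) / (z - cnj (a j)))"
    using assms unfolding blaschke_products_def by blast
  have "(\<lambda>z. \<Prod>j=1..k. (z - a j) / (z - cnj (a j))) holomorphic_on upper_half_plane"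
  proof (intro holomorphic_intros)
    fix j z assume "j \<in> {1..k}" "z \<in> upper_half_plane"
    then show "z - cnj (a j) \<noteq> 0"
      using upper_half_plane_diff_cnj_nonzero[of z "a j"] a by blast
  qed
  then show ?thesis
    by (rule holomorphic_transform) (use b in auto)
qed

text \<open>Where \<open>b1\<close> and \<open>b2\<close> agree, the numerator \<open>b2 + b1\<close> is nonzero because the zeros are disjoint;
  so \<open>g\<close> has a pole there, and the division by zero yields exactly the value 0 that normalisation
  prescribes.\<close>

lemma blaschke_quotient_cont_or_pole:
  assumes b: "b1 \<in> blaschke_products l" "b2 \<in> blaschke_products r"
    and disjoint: "zero_set b1 \<inter> zero_set b2 = {}"
    and distinct: "\<exists>\<zeta>\<in>upper_half_plane. b2 \<zeta> \<noteq> b1 \<zeta>"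
    and g: "\<And>\<zeta>. \<zeta> \<in> upper_half_plane \<Longrightarrow> g \<zeta> = \<i> * ((b2 \<zeta> + b1 \<zeta>) / (b2 \<zeta> - b1 \<zeta>))"
    and z: "z \<in> upper_half_plane"
  shows "isCont g z \<or> is_pole g z \<and> g z = 0"
    and "\<forall>\<^sub>F w in at z. b2 w \<noteq> b1 w \<and> w \<in> upper_half_plane"
proof -
  have hol: "b1 holomorphic_on upper_half_plane" "b2 holomorphic_on upper_half_plane"
    using b by (auto intro: blaschke_product_holomorphic)
  then have cont: "isCont b1 z" "isCont b2 z"
    using z open_upper_half_plane
    by (meson continuous_on_interior holomorphic_on_imp_continuous_on interior_open continuous_on_eq_continuous_at)+
  obtain \<beta> where \<beta>: "\<beta> \<in> upper_half_plane" "b2 \<beta> \<noteq> b1 \<beta>"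
    using distinct by blast
  have "\<forall>\<^sub>F w in at z. b2 w - b1 w \<noteq> 0 \<and> w \<in> upper_half_plane"
    by (rule non_zero_neighbour_alt[of _ _ z \<beta>])
       (use hol open_upper_half_plane convex_upper_half_plane z \<beta> in \<open>auto intro: holomorphic_on_diff convex_connected\<close>)
  then show ev: "\<forall>\<^sub>F w in at z. b2 w \<noteq> b1 w \<and> w \<in> upper_half_plane"
    by eventually_elim auto
  have g_eq: "\<forall>\<^sub>F w in at z. g w = \<i> * ((b2 w + b1 w) / (b2 w - b1 w))"
    using ev by eventually_elim (simp add: g)
  show "isCont g z \<or> is_pole g z \<and> g z = 0"
  proof (cases "b2 z = b1 z")
    case False
    then have "((\<lambda>w. \<i> * ((b2 w + b1 w) / (b2 w - b1 w))) \<longlongrightarrow> g z) (at z)"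
      using cont unfolding g[OF z] isCont_def by (intro tendsto_intros) auto
    then have "(g \<longlongrightarrow> g z) (at z)"
      unfolding tendsto_cong[OF g_eq] .
    then show ?thesis
      by (simp add: isCont_def)
  next
    case True
    then have "b1 z \<noteq> 0"
      using disjoint z by (auto simp: zero_set_def)
    have numerator: "((\<lambda>w. \<i> * (b2 w + b1 w)) \<longlongrightarrow> \<i> * (b2 z + b1 z)) (at z)"
      using cont unfolding isCont_def by (intro tendsto_intros)
    have "((\<lambda>w. b2 w - b1 w) \<longlongrightarrow> b2 z - b1 z) (at z)"
      using cont unfolding isCont_def by (intro tendsto_intros)
    then have "filterlim (\<lambda>w. b2 w - b1 w) (at 0) (at z)"
      unfolding filterlim_at using True ev by (auto elim!: eventually_mono)
    from filterlim_divide_at_infinity[OF numerator this]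
    have "is_pole (\<lambda>w. \<i> * ((b2 w + b1 w) / (b2 w - b1 w))) z"
      using True \<open>b1 z \<noteq> 0\<close> by (simp add: is_pole_def)
    then have "is_pole g z"
      unfolding is_pole_cong[OF g_eq refl] .
    then show ?thesis
      using True by (simp add: g[OF z])
  qed
qed

section \<open>The uniqueness theorem\<close>

theorem theorem3p2:
  fixes \<kappa> r l n :: nat
    and m :: "nat \<Rightarrow> nat"
    and pt :: "nat \<Rightarrow> real"
    and b1 b2 g h :: "complex \<Rightarrow> complex"
  assumes b1: "b1 \<in> blaschke_products l"
    and b2: "b2 \<in> blaschke_products r"
    and disjoint_zeros: "zero_set b1 \<inter> zero_set b2 = {}"
    and g_not_infinity: "\<exists>\<zeta>\<in>upper_half_plane. b2 \<zeta> \<noteq> b1 \<zeta>"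
    and g: "\<And>\<zeta>. \<zeta> \<in> upper_half_plane \<Longrightarrow> g \<zeta> = \<i> * ((b2 \<zeta> + b1 \<zeta>) / (b2 \<zeta> - b1 \<zeta>))"
    and n: "n \<ge> 1"
    and distinct_points: "inj_on pt {2..n}"
    and h: "Some h \<in> generalized_nevanlinna_le \<kappa>"
    and asymp_real: "\<And>j \<epsilon>. \<lbrakk>j \<in> {2..n}; 0 < \<epsilon>; \<epsilon> < pi / 2\<rbrakk> \<Longrightarrow>
      (\<lambda>\<zeta>. h \<zeta> - g \<zeta>) \<in> o[angle_filter_at (pt j) \<epsilon>](\<lambda>\<zeta>. (\<zeta> - complex_of_real (pt j)) ^ m j)"
    and asymp_infinity: "\<And>\<epsilon>. \<lbrakk>0 < \<epsilon>; \<epsilon> < pi / 2\<rbrakk> \<Longrightarrow>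
      (\<lambda>\<zeta>. h \<zeta> - g \<zeta>) \<in> o[angle_filter_infinity \<epsilon>](\<lambda>\<zeta>. complex_of_real (1 / cmod \<zeta> ^ m 1))"
    and many_conditions: "(\<Sum>j=1..n. (m j + 1) div 2) > \<kappa> + l"
  shows "\<forall>\<zeta>\<in>upper_half_plane. h \<zeta> = g \<zeta>"
proof -
  obtain q where q: "q \<le> \<kappa>" and h_mero: "h nicely_meromorphic_on upper_half_plane"
    and h_squares: "has_negative_squares (analyticity_domain h) (nevanlinna_kernel h) q"
    using h unfolding generalized_nevanlinna_le_def generalized_nevanlinna_def by (auto split: if_splits)
  define f where "f z = h z - g z" for z
  \<comment> \<open>\<open>\<Omega>\<close> is the set of regular points of both functions; its complement is discrete in the
    half-plane.\<close>
  define \<Omega> where "\<Omega> = {z \<in> analyticity_domain h. b2 z \<noteq> b1 z}"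
  have \<Omega>_upper: "\<Omega> \<subseteq> upper_half_plane"
    by (auto simp: \<Omega>_def analyticity_domain_def)
  have g_local: "isCont g z \<or> is_pole g z \<and> g z = 0" if "z \<in> upper_half_plane" for z
    by (rule blaschke_quotient_cont_or_pole(1)[OF b1 b2 disjoint_zeros g_not_infinity _ that]) (rule g)
  have b_distinct: "\<forall>\<^sub>F w in at z. b2 w \<noteq> b1 w \<and> w \<in> upper_half_plane" if "z \<in> upper_half_plane" for z
    by (rule blaschke_quotient_cont_or_pole(2)[OF b1 b2 disjoint_zeros g_not_infinity _ that]) (rule g)

  have near: "\<forall>\<^sub>F w in at z. w \<in> \<Omega>" if z: "z \<in> upper_half_plane" for z
  proof -
    have "\<forall>\<^sub>F w in at z. h analytic_on {w}"
      using meromorphic_on_imp_analytic_cosparse[of h upper_half_plane] h_mero z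
      by (simp add: nicely_meromorphic_on_def eventually_cosparse_open_eq open_upper_half_plane)
    with b_distinct[OF z] show ?thesis
      by eventually_elim (simp add: \<Omega>_def analyticity_domain_def)
  qed
  have countable_exceptions: "countable (upper_half_plane - \<Omega>)"
  proof -
    have "eventually (\<lambda>w. w \<in> \<Omega>) (cosparse upper_half_plane)"
      using near by (simp add: eventually_cosparse_open_eq open_upper_half_plane)
    then have "{w. w \<notin> \<Omega>} sparse_in upper_half_plane"
      by (simp add: eventually_cosparse)
    from sparse_imp_countable[OF open_upper_half_plane this]
    show ?thesis
      by (simp add: set_diff_eq Int_def)
  qed

  have "nonneg_modulo \<kappa> (analyticity_domain h) (nevanlinna_kernel h)"
    using h_squares q by (rule has_negative_squares_nonneg_modulo)
  then have h_form: "nonneg_modulo \<kappa> \<Omega> (nevanlinna_kernel h)"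
    by (rule nonneg_modulo_pullback[where \<phi> = id and \<omega> = "\<lambda>_. 1"]) (auto simp: \<Omega>_def)
  have g_form: "nonneg_modulo l \<Omega> (nevanlinna_kernel (\<lambda>z. - g z))"
  proof (rule nonneg_modulo_minus_blaschke_quotient[OF b1 b2])
    show "\<Omega> \<subseteq> {z \<in> upper_half_plane. b2 z \<noteq> b1 z}"
      using \<Omega>_upper by (auto simp: \<Omega>_def)
    show "g z = \<i> * ((b2 z + b1 z) / (b2 z - b1 z))" if "z \<in> \<Omega>" for z
      by (rule g) (use that \<Omega>_upper in blast)
  qed
  have kernel_sum: "nevanlinna_kernel f = (\<lambda>x y. nevanlinna_kernel h x y + nevanlinna_kernel (\<lambda>z. - g z) x y)"
    by (intro ext) (simp add: nevanlinna_kernel_def f_def flip: add_divide_distrib)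
  have f_form: "nonneg_modulo (\<kappa> + l) \<Omega> (nevanlinna_kernel f)"
    unfolding kernel_sum by (rule nonneg_modulo_add[OF h_form g_form])

  \<comment> \<open>Under the inversion the preimage of infinity is 0 and that of \<open>pt j\<close> is \<open>1 / (\<mu> - pt j)\<close>, which
    is finite since \<open>\<mu>\<close> avoids the given points.\<close>
  obtain \<mu> where \<mu>: "\<mu> \<notin> pt ` {2..n}"
    using ex_new_if_finite[OF infinite_UNIV_char_0, of "pt ` {2..n}"] by auto
  define \<phi> where "\<phi> z = complex_of_real \<mu> - 1 / z" for z
  define \<Omega>' where "\<Omega>' = {z. \<phi> z \<in> \<Omega>}"
  define lam where "lam j = (if j = 1 then 0 else 1 / (\<mu> - pt j))" for j
  define p where "p j = (m j + 1) div 2" for j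
  define T where "T = Sigma {1..n} (\<lambda>j. {1..p j})"
  have \<Omega>'_upper: "\<Omega>' \<subseteq> upper_half_plane"
    using \<Omega>_upper inversion_upper_half_plane_iff[of \<mu>] by (auto simp: \<Omega>'_def \<phi>_def)
  have form': "nonneg_modulo (\<kappa> + l) \<Omega>' (nevanlinna_kernel (\<lambda>z. f (\<phi> z)))"
    unfolding \<Omega>'_def \<phi>_def by (rule nonneg_modulo_inversion[OF f_form \<Omega>_upper])
  have \<mu>_ne: "\<mu> \<noteq> pt j" if "j \<in> {2..n}" for j
    using \<mu> that by auto
  have inj_lam: "inj_on lam {1..n}"
  proof (rule inj_onI)
    fix i j assume ij: "i \<in> {1..n}" "j \<in> {1..n}" "lam i = lam j"
    have "lam k \<noteq> 0" if "k \<in> {2..n}" for k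
      using \<mu>_ne[OF that] that by (simp add: lam_def)
    moreover have "k = 1 \<or> k \<in> {2..n}" if "k \<in> {1..n}" for k
      using that by auto
    moreover have "i = j" if "i \<in> {2..n}" "j \<in> {2..n}"
    proof -
      have "pt i = pt j"
        using ij(3) \<mu>_ne that by (simp add: lam_def)
      then show ?thesis
        using distinct_points that by (auto dest: inj_onD)
    qed
    ultimately show "i = j"
      using ij by (metis lam_def)
  qed
  have node_inj: "inj_on (\<lambda>t. \<phi> (cluster_node lam t s)) {0<..}" if "s \<in> T" for s
  proof (rule inj_onI)
    fix t t' assume "\<phi> (cluster_node lam t s) = \<phi> (cluster_node lam t' s)"
    then have "cluster_node lam t s = cluster_node lam t' s"
      by (simp add: \<phi>_def)
    from arg_cong[OF this, of Im] that show "t = t'"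
      by (auto simp: cluster_node_def T_def)
  qed
  have "finite T"
    by (simp add: T_def)
  have "\<exists>\<^sub>F t in at_right 0. \<forall>s\<in>T. \<phi> (cluster_node lam t s) \<notin> upper_half_plane - \<Omega>"
    by (rule frequently_at_right_avoids_countable[OF countable_exceptions \<open>finite T\<close> node_inj])
  from frequently_eventually_frequently[OF this eventually_at_right_less]
  have accessible: "\<exists>\<^sub>F t in at_right 0. \<forall>s\<in>T. cluster_node lam t s \<in> \<Omega>'"
  proof (rule frequently_elim1)
    fix t assume t: "(\<forall>s\<in>T. \<phi> (cluster_node lam t s) \<notin> upper_half_plane - \<Omega>) \<and> 0 < t"
    have "\<phi> (cluster_node lam t s) \<in> upper_half_plane" if "s \<in> T" for s
    proof -
      have "cluster_node lam t s \<in> upper_half_plane"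
        using that t by (auto simp: T_def cluster_node_def upper_half_plane_def)
      then show ?thesis
        unfolding \<phi>_def by (simp only: inversion_upper_half_plane_iff)
    qed
    then show "\<forall>s\<in>T. cluster_node lam t s \<in> \<Omega>'"
      using t by (auto simp: \<Omega>'_def)
  qed
  have decay: "((\<lambda>t. f (\<phi> (cluster_node lam t s)) / complex_of_real t ^ (2 * p (fst s) - 1)) \<longlongrightarrow> 0) (at_right 0)"
    if s: "s \<in> T" for s
  proof -
    obtain j a where ja: "s = (j, a)" "j \<in> {1..n}" "a \<in> {1..p j}"
      using s by (auto simp: T_def)
    \<comment> \<open>Rounding \<open>(m j + 1) / 2\<close> down keeps the order of decay that the nodes need within \<open>m j\<close>.\<close>
    have a: "real a > 0" and exponent: "2 * p j - 1 \<le> m j"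
      using ja(3) by (auto simp: p_def)
    show ?thesis
    proof (cases "j = 1")
      case True
      have "f \<in> o[angle_filter_infinity (pi / 4)](\<lambda>\<zeta>. complex_of_real (1 / cmod \<zeta> ^ m 1))"
        unfolding f_def by (rule asymp_infinity) (use pi_gt_zero in auto)
      from inverted_ray_decay_infinity[OF this a] exponent True show ?thesis
        by (simp add: \<phi>_def cluster_node_def ja(1) lam_def)
    next
      case False
      then have j: "j \<in> {2..n}"
        using ja(2) by auto
      have "f \<in> o[angle_filter_at (pt j) (pi / 4)](\<lambda>\<zeta>. (\<zeta> - complex_of_real (pt j)) ^ m j)"
        unfolding f_def by (rule asymp_real[OF j]) (use pi_gt_zero in auto)
      from inverted_ray_decay_real[OF this a exponent \<mu>_ne[OF j]] False show ?thesis
        by (simp add: \<phi>_def cluster_node_def ja(1) lam_def)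
    qed
  qed
  have "finite {z \<in> \<Omega>'. f (\<phi> z) \<noteq> 0}"
    by (rule finite_nonzero_set_if_boundary_decay[OF form' \<Omega>'_upper _ inj_lam])
       (use accessible decay many_conditions in \<open>auto simp: T_def p_def\<close>)
  then have "finite (\<phi> ` {z \<in> \<Omega>'. f (\<phi> z) \<noteq> 0})"
    by (rule finite_imageI)
  moreover have "{z \<in> \<Omega>. f z \<noteq> 0} \<subseteq> \<phi> ` {z \<in> \<Omega>'. f (\<phi> z) \<noteq> 0}"
  proof
    fix z assume z: "z \<in> {z \<in> \<Omega>. f z \<noteq> 0}"
    then have "complex_of_real \<mu> - z \<noteq> 0"
      using \<Omega>_upper by (auto simp: upper_half_plane_def)
    then have "\<phi> (1 / (complex_of_real \<mu> - z)) = z"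
      by (simp add: \<phi>_def)
    then show "z \<in> \<phi> ` {z \<in> \<Omega>'. f (\<phi> z) \<noteq> 0}"
      using z by (intro image_eqI[of _ _ "1 / (complex_of_real \<mu> - z)"]) (auto simp: \<Omega>'_def)
  qed
  ultimately have finite_difference: "finite {z \<in> \<Omega>. f z \<noteq> 0}"
    by (rule finite_subset[rotated])

  show ?thesis
  proof
    fix z assume z: "z \<in> upper_half_plane"
    have "\<forall>\<^sub>F w in at z. w \<notin> {z \<in> \<Omega>. f z \<noteq> 0}"
      using islimpt_finite[OF finite_difference, of z] unfolding islimpt_iff_eventually by simp
    with near[OF z] have "\<forall>\<^sub>F w in at z. h w = g w"
      by eventually_elim (simp add: f_def)
    moreover have "h nicely_meromorphic_on {z}"
      using h_mero by (rule nicely_meromorphic_on_subset) (use z in simp)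
    ultimately show "h z = g z"
      using g_local[OF z] by (intro nicely_meromorphic_eq_if_eventually_eq)
  qed
qed

end
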